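(* Let $q$ be a prime power and let $a,b\ge 2$ be integers. If $J_q(a;b)$ is DOT, then $J_q(a';b)$ is DOT for all integers $a'\ge a$.
   Context: $J_q(n,k)$ is the set of all $k$-dimensional subspaces of $\mathbb{F}_q^n$, and $J_q(a;b)$ denotes $J_q(a+b,b)$. A point is a one-dimensional subspace of $\mathbb{F}_q^n$. A function $f\colon J_q(n,k)\to\mathbb{R}$ is Boolean if $f(V)\in\{0,1\}$ for all $V$, and has degree one if $f=\sum_p c_p x_p$ for some real coefficients $c_p$, where the sum is over all points $p$ and $x_p(V)=1$ if $p\subseteq V$, $x_p(V)=0$ otherwise. For a point $r$, $y_r(V)=1$ if $V$ is orthogonal to $r$ (i.e. $V\subseteq r^\perp$), and $y_r(V)=0$ otherwise; orthogonality is with respect to the standard bilinear form on $\mathbb{F}_q^n$. A Boolean degree one function on $J_q(n,k)$ is trivial if it is one of $0,\ 1,\ x_p,\ 1-x_p,\ y_r,\ 1-y_r,\ x_p+y_r,\ 1-x_p-y_r$ for some points $p,r$, where in the last two cases $p\not\perp r$. $J_q(n,k)$ is degree-one trivial (DOT) if all Boolean degree one functions on $J_q(n,k)$ are trivial. *)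

theory Defs
  imports Jordan_Normal_Form.VS_Connect Complex_Main
begin

text \<open>
  The field \<open>\<F>\<^sub>q\<close> is a type \<open>'q\<close> of classes \<open>field\<close> and \<open>finite\<close>, with \<open>q = CARD('q)\<close>;
  \<open>module_vec F n\<close> is \<open>\<F>\<^sub>q\<^sup>n\<close> (carrier \<open>carrier_vec n\<close>), and \<open>class_ring\<close> is the field \<open>'q\<close> as a record.
\<close>

definition grassmannian :: "'q::{field,finite} itself \<Rightarrow> nat \<Rightarrow> nat \<Rightarrow> 'q vec set set" where
  "grassmannian F n k =
    {V. subspace class_ring V (module_vec F n) \<and>
        vectorspace.dim class_ring (module_vec F n\<lparr>carrier := V\<rparr>) = k}"

abbreviation points :: "'q::{field,finite} itself \<Rightarrow> nat \<Rightarrow> 'q vec set set" where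
  "points F n \<equiv> grassmannian F n 1"

definition orthogonal_spaces :: "'q::{field,finite} vec set \<Rightarrow> 'q vec set \<Rightarrow> bool" where
  "orthogonal_spaces V W \<longleftrightarrow> (\<forall>v\<in>V. \<forall>w\<in>W. v \<bullet> w = 0)"

definition x_fun :: "'q::{field,finite} vec set \<Rightarrow> 'q vec set \<Rightarrow> real" where
  "x_fun p V = (if p \<subseteq> V then 1 else 0)"

definition y_fun :: "'q::{field,finite} vec set \<Rightarrow> 'q vec set \<Rightarrow> real" where
  "y_fun r V = (if orthogonal_spaces V r then 1 else 0)"

text \<open>
  A function on \<open>J\<^sub>q(n,k)\<close> is a total function on sets of vectors, of which only the values on
  \<open>grassmannian F n k\<close> matter: all the properties below, equalities of functions included,
  are restricted to that set.
\<close>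

definition boolean_on :: "'a set \<Rightarrow> ('a \<Rightarrow> real) \<Rightarrow> bool" where
  "boolean_on J f \<longleftrightarrow> (\<forall>V\<in>J. f V \<in> {0, 1})"

definition degree_one ::
    "'q::{field,finite} itself \<Rightarrow> nat \<Rightarrow> nat \<Rightarrow> ('q vec set \<Rightarrow> real) \<Rightarrow> bool" where
  "degree_one F n k f \<longleftrightarrow>
    (\<exists>c :: 'q vec set \<Rightarrow> real. \<forall>V\<in>grassmannian F n k. f V = (\<Sum>p\<in>points F n. c p * x_fun p V))"

definition equal_on :: "'a set \<Rightarrow> ('a \<Rightarrow> real) \<Rightarrow> ('a \<Rightarrow> real) \<Rightarrow> bool" where
  "equal_on J f g \<longleftrightarrow> (\<forall>V\<in>J. f V = g V)"

definition trivial_function ::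
    "'q::{field,finite} itself \<Rightarrow> nat \<Rightarrow> nat \<Rightarrow> ('q vec set \<Rightarrow> real) \<Rightarrow> bool" where
  "trivial_function F n k f \<longleftrightarrow>
    (let eq = equal_on (grassmannian F n k) f in
      eq (\<lambda>V. 0) \<or>
      eq (\<lambda>V. 1) \<or>
      (\<exists>p\<in>points F n. eq (\<lambda>V. x_fun p V)) \<or>
      (\<exists>p\<in>points F n. eq (\<lambda>V. 1 - x_fun p V)) \<or>
      (\<exists>r\<in>points F n. eq (\<lambda>V. y_fun r V)) \<or>
      (\<exists>r\<in>points F n. eq (\<lambda>V. 1 - y_fun r V)) \<or>
      (\<exists>p\<in>points F n. \<exists>r\<in>points F n. \<not> orthogonal_spaces p r \<and>
        eq (\<lambda>V. x_fun p V + y_fun r V)) \<or>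
      (\<exists>p\<in>points F n. \<exists>r\<in>points F n. \<not> orthogonal_spaces p r \<and>
        eq (\<lambda>V. 1 - x_fun p V - y_fun r V)))"

definition degree_one_trivial :: "'q::{field,finite} itself \<Rightarrow> nat \<Rightarrow> nat \<Rightarrow> bool" where
  "degree_one_trivial F n k \<longleftrightarrow>
    (\<forall>f. boolean_on (grassmannian F n k) f \<and> degree_one F n k f \<longrightarrow> trivial_function F n k f)"

text \<open>
  \<open>J\<^sub>q(a;b) = J\<^sub>q(a + b, b)\<close> is DOT; note that \<open>b\<close>, the second parameter, is the dimension of
  the subspaces.
\<close>

abbreviation DOT :: "'q::{field,finite} itself \<Rightarrow> nat \<Rightarrow> nat \<Rightarrow> bool" where
  "DOT F a b \<equiv> degree_one_trivial F (a + b) b"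

text \<open>The sum in \<open>degree_one\<close> is over a finite set.\<close>

lemma finite_grassmannian: "finite (grassmannian F n k)" for F :: "'q::{field,finite} itself"
proof -
  have "finite (carrier_vec n :: 'q vec set)"
  proof (rule finite_subset)
    show "carrier_vec n \<subseteq> vec_of_list ` {xs :: 'q list. set xs \<subseteq> UNIV \<and> length xs = n}"
    proof
      fix v :: "'q vec" assume "v \<in> carrier_vec n"
      then have "length (list_of_vec v) = n" by auto
      moreover have "v = vec_of_list (list_of_vec v)" by (simp add: vec_list)
      ultimately show "v \<in> vec_of_list ` {xs. set xs \<subseteq> UNIV \<and> length xs = n}" by blast
    qed
    show "finite (vec_of_list ` {xs :: 'q list. set xs \<subseteq> UNIV \<and> length xs = n})"
      by (intro finite_imageI finite_lists_length_eq finite_UNIV)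
  qed
  moreover have "grassmannian F n k \<subseteq> Pow (carrier_vec n)"
    unfolding grassmannian_def subspace_def submodule_def
    by (auto simp: module_vec_simps)
  ultimately show ?thesis by (meson finite_Pow_iff finite_subset)
qed

end

theory Submission
  imports Defs "HOL-Library.Cardinality"
begin

text \<open>
  Write \<open>q\<close> for the number of field elements. By induction it is enough to pass from \<open>J\<^sub>q(n,k)\<close> to
  \<open>J\<^sub>q(n+1,k)\<close>, where \<open>k = b\<close> and \<open>n = a' + b\<close>, so that \<open>2 \<le> k < n\<close> and \<open>n \<ge> 4\<close>.

  The functions \<open>x\<^sub>p\<close> on \<open>J\<^sub>q(n,k)\<close> are linearly independent for \<open>2 \<le> k < n\<close>
  (\<open>projective_zero_if_sums_zero\<close>), hence a degree one function is the same as its family of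
  coefficients \<open>c\<^sub>p\<close>, and the trivial functions are characterized by explicit coefficients
  (\<open>degree_one_trivial_iff\<close>): up to replacing \<open>f\<close> by \<open>1 - f\<close>, they take one nonzero value off
  a hyperplane (which may be absent) and \<open>0\<close> on it, with a correction at one point (which
  may be absent) that does not lie on the hyperplane.

  Let \<open>f\<close> be a Boolean degree one function on \<open>J\<^sub>q(n+1,k)\<close> with coefficients \<open>c\<close>. Its restriction to
  the subspaces of a hyperplane \<open>H\<close> of the vector space of dimension \<open>n + 1\<close> has as
  coefficients the restriction of \<open>c\<close>, and is trivial by hypothesis. Coefficients of the two kinds, \<open>f\<close> and \<open>1 - f\<close>, have disjoint sets of values
  (\<open>std_values_disjoint\<close>), so the kind is the same for all \<open>H\<close> through a fixed point. In
  the first kind, the value of \<open>c\<close> at a point tells whether the point lies on the hyperplane and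
  whether it is the special point. Since any two points lie together with the fixed point on a common \<open>H\<close>,
  the local hyperplanes fit together to a subspace of codimension at most one, and there is at
  most one special point globally (\<open>is_std_coeff_glue\<close>). Therefore \<open>f\<close> is trivial.
\<close>

section \<open>Subspaces as sets of vectors\<close>

text \<open>
  A subspace of \<open>\<F>\<^sub>q\<^sup>n\<close> described by closure properties only. Over a finite field the dimension
  is determined by the cardinality, so \<open>grassmannian F n k\<close> consists of the subspaces of
  cardinality \<open>q\<^sup>k\<close> (\<open>grassmannian_iff_card\<close>).
\<close>

definition vec_subspace :: "nat \<Rightarrow> 'q::{field,finite} vec set \<Rightarrow> bool" where
  "vec_subspace n V \<longleftrightarrow> V \<subseteq> carrier_vec n \<and> 0\<^sub>v n \<in> V \<and>
    (\<forall>u\<in>V. \<forall>v\<in>V. u + v \<in> V) \<and> (\<forall>t. \<forall>v\<in>V. t \<cdot>\<^sub>v v \<in> V)"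

lemma vec_subspaceD:
  assumes "vec_subspace n V"
  shows "v \<in> V \<Longrightarrow> v \<in> carrier_vec n" "0\<^sub>v n \<in> V" "u \<in> V \<Longrightarrow> v \<in> V \<Longrightarrow> u + v \<in> V"
    "v \<in> V \<Longrightarrow> t \<cdot>\<^sub>v v \<in> V"
  using assms unfolding vec_subspace_def by auto

lemma vec_subspace_iff_subspace:
  "subspace class_ring V (module_vec F n) \<longleftrightarrow> vec_subspace n V"
  for F :: "'q::{field,finite} itself"
proof -
  have M: "module_vec F n = module_vec TYPE('q) n"
    by (simp add: module_vec_def)
  show ?thesis
    unfolding M subspace_def submodule_def vec_subspace_def
    using vec_vs[where 'a='q and n=n] vec_module[where 'a='q and n=n]
    by (auto simp: module_vec_simps)
qed

lemma (in vectorspace) card_eq_power_dim: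
  assumes "finite (carrier V)"
  shows "card (carrier V) = card (carrier K) ^ dim"
proof -
  have "gen_set (carrier V)"
    using in_own_span[of "carrier V"] span_is_subset2[of "carrier V"] by auto
  then have fd: "fin_dim"
    using assms unfolding fin_dim_def by blast
  obtain B where B: "finite B" "basis B"
    using finite_basis_exists[OF fd] by blast
  have BV: "B \<subseteq> carrier V"
    using B unfolding basis_def by auto
  have "bij_betw (\<lambda>a. lincomb a B) (B \<rightarrow>\<^sub>E carrier K) (carrier V)"
    unfolding bij_betw_def inj_on_def
  proof (intro conjI ballI impI)
    have uniq: "\<forall>v\<in>carrier V. \<exists>!a. a \<in> B \<rightarrow>\<^sub>E carrier K \<and> lincomb a B = v"
      using basis_criterion[OF B(1) BV] B(2) by blast
    have clos: "lincomb a B \<in> carrier V" if "a \<in> B \<rightarrow>\<^sub>E carrier K" for a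
      using that by (intro lincomb_closed BV) auto
    fix a b assume "a \<in> B \<rightarrow>\<^sub>E carrier K" "b \<in> B \<rightarrow>\<^sub>E carrier K" "lincomb a B = lincomb b B"
    then show "a = b" using uniq clos by metis
  next
    have uniq: "\<forall>v\<in>carrier V. \<exists>!a. a \<in> B \<rightarrow>\<^sub>E carrier K \<and> lincomb a B = v"
      using basis_criterion[OF B(1) BV] B(2) by blast
    have clos: "lincomb a B \<in> carrier V" if "a \<in> B \<rightarrow>\<^sub>E carrier K" for a
      using that by (intro lincomb_closed BV) auto
    show "(\<lambda>a. lincomb a B) ` (B \<rightarrow>\<^sub>E carrier K) = carrier V"
    proof (intro equalityI subsetI)
      fix v assume "v \<in> carrier V"
      then obtain a where "a \<in> B \<rightarrow>\<^sub>E carrier K" "lincomb a B = v" using uniq by blast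
      then show "v \<in> (\<lambda>a. lincomb a B) ` (B \<rightarrow>\<^sub>E carrier K)" by blast
    qed (use clos in auto)
  qed
  then have "card (carrier V) = card (B \<rightarrow>\<^sub>E carrier K)"
    by (metis bij_betw_same_card)
  also have "\<dots> = card (carrier K) ^ card B"
    using B(1) by (simp add: card_PiE)
  also have "card B = dim"
    using dim_basis[OF B] by simp
  finally show ?thesis .
qed

lemma finite_carrier_vec: "finite (carrier_vec n :: 'q::{field,finite} vec set)"
proof -
  have "carrier_vec n \<subseteq> vec_of_list ` {xs :: 'q list. set xs \<subseteq> UNIV \<and> length xs = n}"
  proof
    fix v :: "'q vec" assume "v \<in> carrier_vec n"
    then have "length (list_of_vec v) = n" by auto
    moreover have "v = vec_of_list (list_of_vec v)" by (simp add: vec_list)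
    ultimately show "v \<in> vec_of_list ` {xs. set xs \<subseteq> UNIV \<and> length xs = n}" by blast
  qed
  then show ?thesis
    by (rule finite_subset) (intro finite_imageI finite_lists_length_eq finite)
qed

lemma vec_subspace_finite: "vec_subspace n V \<Longrightarrow> finite V"
  unfolding vec_subspace_def using finite_carrier_vec finite_subset by blast

lemma card_vec_subspace:
  fixes F :: "'q::{field,finite} itself"
  assumes "vec_subspace n (V :: 'q vec set)"
  shows "card V = CARD('q) ^ vectorspace.dim class_ring (module_vec F n\<lparr>carrier := V\<rparr>)"
proof -
  have M: "module_vec F n = module_vec TYPE('q) n"
    by (simp add: module_vec_def)
  interpret vs: vectorspace "class_ring :: 'q ring" "module_vec F n"
    unfolding M by (rule vec_vs)
  interpret vectorspace "class_ring :: 'q ring" "module_vec F n\<lparr>carrier := V\<rparr>"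
    using assms vec_subspace_iff_subspace[of V F n] by (intro vs.subspace_is_vs) simp
  show ?thesis
    using card_eq_power_dim vec_subspace_finite[OF assms] by simp
qed

lemma card_field_ge2: "CARD('q::{field,finite}) \<ge> 2"
proof -
  have "card {0::'q, 1} \<le> CARD('q)" by (rule card_mono) auto
  then show ?thesis by simp
qed

lemma grassmannian_iff_card:
  "V \<in> grassmannian F n k \<longleftrightarrow> vec_subspace n V \<and> card V = CARD('q) ^ k"
  for F :: "'q::{field,finite} itself"
  unfolding grassmannian_def mem_Collect_eq vec_subspace_iff_subspace
  using card_vec_subspace[of n V F] card_field_ge2[where 'q='q]
  by (auto simp: power_inject_exp)

lemma card_carrier_vec: "card (carrier_vec n :: 'q::{field,finite} vec set) = CARD('q) ^ n"
proof -
  interpret vec_space "TYPE('q)" n .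
  show ?thesis
    using card_eq_power_dim finite_carrier_vec[where 'q='q] dim_is_n by simp
qed

lemma vec_subspace_carrier: "vec_subspace n (carrier_vec n)"
  unfolding vec_subspace_def by auto

section \<open>Orthogonality and counting\<close>

lemma vec_subspace_kernel:
  assumes "vec_subspace n V" "w \<in> carrier_vec n"
  shows "vec_subspace n {v \<in> V. w \<bullet> v = 0}"
  using assms unfolding vec_subspace_def
  by (auto simp: scalar_prod_add_distrib[of w n] subset_iff)

text \<open>
  The fibres of a nonzero linear functional on \<open>V\<close> all have the same size.
\<close>

lemma card_kernel:
  fixes V :: "'q::{field,finite} vec set"
  assumes V: "vec_subspace n V" and w: "w \<in> carrier_vec n" and x: "x \<in> V" "w \<bullet> x \<noteq> 0"
  shows "card {v \<in> V. w \<bullet> v = 0} * CARD('q) = card V"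
proof -
  note VD = vec_subspaceD[OF V]
  define K where "K = {v \<in> V. w \<bullet> v = 0}"
  define y where "y = (1 / (w \<bullet> x)) \<cdot>\<^sub>v x"
  have y: "y \<in> V" "w \<bullet> y = 1"
    using x VD w unfolding y_def by auto
  have add: "w \<bullet> (u + t \<cdot>\<^sub>v y) = w \<bullet> u + t" if "u \<in> V" for u t
    using that y VD w by (subst scalar_prod_add_distrib[of w n]) auto
  have "bij_betw (\<lambda>(u, t). u + t \<cdot>\<^sub>v y) (K \<times> (UNIV :: 'q set)) V"
  proof (rule bij_betwI[where g = "\<lambda>v. (v + (- (w \<bullet> v)) \<cdot>\<^sub>v y, w \<bullet> v)"])
    show "(\<lambda>(u, t). u + t \<cdot>\<^sub>v y) \<in> K \<times> UNIV \<rightarrow> V"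
      using y VD unfolding K_def by auto
    show "(\<lambda>v. (v + (- (w \<bullet> v)) \<cdot>\<^sub>v y, w \<bullet> v)) \<in> V \<rightarrow> K \<times> UNIV"
      using y VD add unfolding K_def by auto
  next
    fix p assume "p \<in> K \<times> (UNIV :: 'q set)"
    then obtain u t where p: "p = (u, t)" "u \<in> V" "w \<bullet> u = 0"
      unfolding K_def by auto
    have "u + t \<cdot>\<^sub>v y + (- t) \<cdot>\<^sub>v y = u"
      using VD(1)[OF p(2)] VD(1)[OF y(1)] by (intro eq_vecI) auto
    then show "(\<lambda>v. (v + (- (w \<bullet> v)) \<cdot>\<^sub>v y, w \<bullet> v)) (case p of (u, t) \<Rightarrow> u + t \<cdot>\<^sub>v y) = p"
      using p add by simp
  next
    fix v assume v: "v \<in> V"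
    have "v + (- (w \<bullet> v)) \<cdot>\<^sub>v y + (w \<bullet> v) \<cdot>\<^sub>v y = v"
      using VD(1)[OF v] VD(1)[OF y(1)] by (intro eq_vecI) auto
    then show "(case (v + (- (w \<bullet> v)) \<cdot>\<^sub>v y, w \<bullet> v) of (u, t) \<Rightarrow> u + t \<cdot>\<^sub>v y) = v"
      by simp
  qed
  then have "card (K \<times> (UNIV :: 'q set)) = card V"
    by (rule bij_betw_same_card)
  then show ?thesis
    unfolding K_def by (simp add: card_cartesian_product)
qed

lemma card_le_card_kernel:
  fixes V :: "'q::{field,finite} vec set"
  assumes V: "vec_subspace n V" and w: "w \<in> carrier_vec n"
  shows "card V \<le> card {v \<in> V. w \<bullet> v = 0} * CARD('q)"
proof (cases "\<exists>x\<in>V. w \<bullet> x \<noteq> 0")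
  case True
  then show ?thesis using card_kernel[OF V w] by auto
next
  case False
  then have "{v \<in> V. w \<bullet> v = 0} = V" by auto
  then show ?thesis by simp
qed

lemma nonzero_vec_coordinate:
  assumes "v \<in> carrier_vec n" "v \<noteq> 0\<^sub>v n"
  obtains i where "i < n" "v $ i \<noteq> 0"
proof -
  have "\<exists>i<n. v $ i \<noteq> 0"
  proof (rule ccontr)
    assume "\<not> ?thesis"
    then have "v = 0\<^sub>v n" using assms(1) by (intro eq_vecI) auto
    then show False using assms(2) by simp
  qed
  then show thesis using that by blast
qed

lemma card_perp:
  fixes w :: "'q::{field,finite} vec"
  assumes "w \<in> carrier_vec n" "w \<noteq> 0\<^sub>v n"
  shows "card {v \<in> carrier_vec n. w \<bullet> v = 0} * CARD('q) = CARD('q) ^ n"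
proof -
  obtain i where "i < n" "w $ i \<noteq> 0"
    using nonzero_vec_coordinate[OF assms] .
  then have "w \<bullet> unit_vec n i \<noteq> 0" by simp
  then show ?thesis
    using card_kernel[OF vec_subspace_carrier assms(1), of "unit_vec n i"]
    by (simp add: card_carrier_vec)
qed

text \<open>
  The span of one vector; \<open>line 0\<close> is the zero space.
\<close>

definition line :: "'q::field vec \<Rightarrow> 'q vec set" where
  "line u = range (\<lambda>t. t \<cdot>\<^sub>v u)"

lemma in_line_if_perp:
  fixes u v :: "'q::field vec"
  assumes u: "u \<in> carrier_vec n" "u \<noteq> 0\<^sub>v n" and v: "v \<in> carrier_vec n"
    and perp: "\<And>w. w \<in> carrier_vec n \<Longrightarrow> w \<bullet> u = 0 \<Longrightarrow> w \<bullet> v = 0"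
  shows "v \<in> line u"
proof -
  obtain j where j: "j < n" "u $ j \<noteq> 0" using nonzero_vec_coordinate[OF u] .
  have "v = (v $ j / u $ j) \<cdot>\<^sub>v u"
  proof (rule eq_vecI)
    fix i assume "i < dim_vec ((v $ j / u $ j) \<cdot>\<^sub>v u)"
    then have i: "i < n" using u by auto
    let ?w = "u $ j \<cdot>\<^sub>v unit_vec n i + (- (u $ i)) \<cdot>\<^sub>v unit_vec n j"
    have prod: "?w \<bullet> z = u $ j * z $ i - u $ i * z $ j" if "z \<in> carrier_vec n" for z
      using that i j by (subst add_scalar_prod_distrib[of _ n]) auto
    have "u $ j * v $ i - u $ i * v $ j = 0"
      using perp[of ?w] prod[OF u(1)] prod[OF v] by simp
    then show "v $ i = ((v $ j / u $ j) \<cdot>\<^sub>v u) $ i"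
      using j i u by (simp add: field_simps)
  qed (use u v in auto)
  then show ?thesis unfolding line_def by blast
qed

lemma card_perp_pair:
  fixes u v :: "'q::{field,finite} vec"
  assumes u: "u \<in> carrier_vec n" "u \<noteq> 0\<^sub>v n" and v: "v \<in> carrier_vec n"
  shows "card {w \<in> carrier_vec n. u \<bullet> w = 0 \<and> v \<bullet> w = 0} * CARD('q) * CARD('q) =
    (if v \<in> line u then CARD('q) ^ n * CARD('q) else CARD('q) ^ n)"
proof (cases "v \<in> line u")
  case True
  then obtain t where t: "v = t \<cdot>\<^sub>v u" unfolding line_def by auto
  have "{w \<in> carrier_vec n. u \<bullet> w = 0 \<and> v \<bullet> w = 0} = {w \<in> carrier_vec n. u \<bullet> w = 0}"
    unfolding t using u by auto
  then show ?thesis using True card_perp[OF u] by simp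
next
  case False
  let ?K = "{w \<in> carrier_vec n. u \<bullet> w = 0}"
  have "\<exists>x\<in>?K. v \<bullet> x \<noteq> 0"
  proof (rule ccontr)
    assume "\<not> ?thesis"
    then have "\<And>w. w \<in> carrier_vec n \<Longrightarrow> w \<bullet> u = 0 \<Longrightarrow> w \<bullet> v = 0"
      using comm_scalar_prod[OF u(1)] comm_scalar_prod[OF v] by simp
    then show False using in_line_if_perp[OF u v] False by blast
  qed
  then obtain x where x: "x \<in> ?K" "v \<bullet> x \<noteq> 0" by blast
  have "{w \<in> carrier_vec n. u \<bullet> w = 0 \<and> v \<bullet> w = 0} = {w \<in> ?K. v \<bullet> w = 0}"
    by auto
  then show ?thesis
    using False card_perp[OF u] v
      card_kernel[OF vec_subspace_kernel[OF vec_subspace_carrier u(1)] v x]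
    by simp
qed

text \<open>
  Coefficients \<open>c\<^sub>p\<close> are encoded as a function of vectors that is constant on the nonzero vectors of
  each point and vanishes at \<open>0\<close>. A degree one function then has the form \<open>V \<mapsto> \<Sum>v\<in>V. c v\<close>; the
  coefficient of a point \<open>p\<close> is the sum of \<open>c\<close> over \<open>p\<close>, that is \<open>q - 1\<close> times the common value.
\<close>

definition projective :: "nat \<Rightarrow> ('q::field vec \<Rightarrow> real) \<Rightarrow> bool" where
  "projective n c \<longleftrightarrow> c (0\<^sub>v n) = 0 \<and> (\<forall>v\<in>carrier_vec n. \<forall>t. t \<noteq> 0 \<longrightarrow> c (t \<cdot>\<^sub>v v) = c v)"

lemma projectiveD:
  assumes "projective n c"
  shows "c (0\<^sub>v n) = 0" "v \<in> carrier_vec n \<Longrightarrow> t \<noteq> 0 \<Longrightarrow> c (t \<cdot>\<^sub>v v) = c v"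
  using assms unfolding projective_def by auto

lemma inj_smult_vec:
  fixes u :: "'q::field vec"
  assumes "u \<in> carrier_vec n" "u \<noteq> 0\<^sub>v n"
  shows "inj (\<lambda>t. t \<cdot>\<^sub>v u)"
proof (rule injI)
  fix s t assume eq: "s \<cdot>\<^sub>v u = t \<cdot>\<^sub>v u"
  obtain j where j: "j < n" "u $ j \<noteq> 0" using nonzero_vec_coordinate[OF assms] .
  have "s * u $ j = t * u $ j"
    using arg_cong[OF eq, of "\<lambda>v. v $ j"] j assms by simp
  then show "s = t" using j by simp
qed

lemma smult_vec_eq_zero:
  fixes u :: "'q::field vec"
  assumes "u \<in> carrier_vec n" "u \<noteq> 0\<^sub>v n"
  shows "t \<cdot>\<^sub>v u = 0\<^sub>v n \<longleftrightarrow> t = 0"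
proof -
  have "0 \<cdot>\<^sub>v u = 0\<^sub>v n" using assms by auto
  then show ?thesis using inj_smult_vec[OF assms] by (metis injD)
qed

lemma sum_line:
  fixes c :: "'q::{field,finite} vec \<Rightarrow> real"
  assumes c: "projective n c" and u: "u \<in> carrier_vec n" "u \<noteq> 0\<^sub>v n"
  shows "sum c (line u) = (real CARD('q) - 1) * c u"
proof -
  have "sum c (line u) = (\<Sum>t\<in>UNIV. c (t \<cdot>\<^sub>v u))"
    unfolding line_def using inj_smult_vec[OF u] by (simp add: sum.reindex)
  also have "\<dots> = c (0 \<cdot>\<^sub>v u) + (\<Sum>t\<in>UNIV - {0}. c (t \<cdot>\<^sub>v u))"
    by (rule sum.remove) auto
  also have "0 \<cdot>\<^sub>v u = 0\<^sub>v n" using u by auto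
  also have "(\<Sum>t\<in>UNIV - {0::'q}. c (t \<cdot>\<^sub>v u)) = (\<Sum>t\<in>UNIV - {0::'q}. c u)"
    using projectiveD[OF c] u by (intro sum.cong) auto
  finally show ?thesis
    using projectiveD(1)[OF c] card_field_ge2[where 'q='q]
    by (simp add: card_Diff_singleton of_nat_diff)
qed

lemma line_subset_carrier: "u \<in> carrier_vec n \<Longrightarrow> line u \<subseteq> carrier_vec n"
  unfolding line_def by auto

text \<open>
  Double counting. Summing the hypothesis over all normal vectors \<open>w\<close> shows that the total
  \<open>T\<close> of \<open>c\<close> satisfies \<open>q T = q\<^sup>n T\<close>, hence vanishes. Summing over the normal vectors orthogonal
  to \<open>u\<close> then isolates the nonzero vectors of \<open>line u\<close>, because these are orthogonal to \<open>q ^ (n - 1)\<close>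
  such vectors and all others to \<open>q ^ (n - 2)\<close>.
\<close>

lemma projective_zero_if_hyperplane_sums_zero:
  fixes c :: "'q::{field,finite} vec \<Rightarrow> real"
  assumes n: "n \<ge> 2" and c: "projective n c"
    and zero: "\<And>w. w \<in> carrier_vec n \<Longrightarrow> w \<noteq> 0\<^sub>v n \<Longrightarrow>
      (\<Sum>v | v \<in> carrier_vec n \<and> w \<bullet> v = 0. c v) = 0"
    and u: "u \<in> carrier_vec n"
  shows "c u = 0"
proof (cases "u = 0\<^sub>v n")
  case False
  define q where "q = real CARD('q)"
  have q: "q \<ge> 2" using card_field_ge2[where 'q='q] unfolding q_def by linarith
  define X where "X = (carrier_vec n :: 'q vec set)"
  have fX: "finite X" unfolding X_def by (rule finite_carrier_vec)
  define T where "T = sum c X"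
  \<comment> \<open>in the sum over normal vectors \<open>w \<in> A\<close> only \<open>w = 0\<close> contributes\<close>
  have sumA: "(\<Sum>v\<in>X. c v * real (card {w \<in> A. w \<bullet> v = 0})) = T"
    if A: "A \<subseteq> X" "0\<^sub>v n \<in> A" for A
  proof -
    have fA: "finite A" using A fX finite_subset by blast
    have "(\<Sum>v\<in>X. c v * real (card {w \<in> A. w \<bullet> v = 0})) = (\<Sum>v\<in>X. \<Sum>w | w \<in> A \<and> w \<bullet> v = 0. c v)"
      by (simp add: mult.commute)
    also have "\<dots> = (\<Sum>w\<in>A. \<Sum>v | v \<in> X \<and> w \<bullet> v = 0. c v)"
      by (rule sum.swap_restrict[OF fX fA])
    also have "\<dots> = (\<Sum>w\<in>A. if w = 0\<^sub>v n then T else 0)"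
    proof (rule sum.cong[OF refl])
      fix w assume w: "w \<in> A"
      show "(\<Sum>v | v \<in> X \<and> w \<bullet> v = 0. c v) = (if w = 0\<^sub>v n then T else 0)"
      proof (cases "w = 0\<^sub>v n")
        case True
        then have "{v. v \<in> X \<and> w \<bullet> v = 0} = X" unfolding X_def by auto
        then show ?thesis using True unfolding T_def by simp
      next
        case False
        then show ?thesis using zero[of w] w A unfolding X_def by auto
      qed
    qed
    also have "\<dots> = T" using A(2) fA by (simp add: sum.delta)
    finally show ?thesis .
  qed
  have "q * T = q * (\<Sum>v\<in>X. c v * real (card {w \<in> X. w \<bullet> v = 0}))"
    by (subst sumA) (auto simp: X_def)
  also have "\<dots> = (\<Sum>v\<in>X. c v * (q * real (card {w \<in> X. w \<bullet> v = 0})))"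
    by (simp add: sum_distrib_left mult_ac)
  also have "\<dots> = (\<Sum>v\<in>X. q ^ n * c v)"
  proof (rule sum.cong[OF refl])
    fix v assume v: "v \<in> X"
    show "c v * (q * real (card {w \<in> X. w \<bullet> v = 0})) = q ^ n * c v"
    proof (cases "v = 0\<^sub>v n")
      case True
      then show ?thesis using projectiveD(1)[OF c] by simp
    next
      case False
      have "{w \<in> X. w \<bullet> v = 0} = {w \<in> carrier_vec n. v \<bullet> w = 0}"
        using v comm_scalar_prod[of v n] unfolding X_def by auto
      then have "card {w \<in> X. w \<bullet> v = 0} * CARD('q) = CARD('q) ^ n"
        using card_perp[of v n] False v unfolding X_def by simp
      then have "real (card {w \<in> X. w \<bullet> v = 0}) * q = q ^ n"
        unfolding q_def by (metis of_nat_mult of_nat_power)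
      then show ?thesis by (simp add: mult_ac)
    qed
  qed
  finally have "q * T = q ^ n * T"
    unfolding T_def by (simp add: sum_distrib_left)
  moreover have "q ^ 1 < q ^ n" by (rule power_strict_increasing) (use q n in auto)
  ultimately have T: "T = 0" by auto
  have "0 = q * q * (\<Sum>v\<in>X. c v * real (card {w \<in> {w \<in> X. u \<bullet> w = 0}. w \<bullet> v = 0}))"
    using u T by (subst sumA) (auto simp: X_def)
  also have "\<dots> = (\<Sum>v\<in>X. c v * (real (card {w \<in> {w \<in> X. u \<bullet> w = 0}. w \<bullet> v = 0}) * q * q))"
    by (simp add: sum_distrib_left mult_ac)
  also have "\<dots> = (\<Sum>v\<in>X. c v * (if v \<in> line u then q ^ n * q else q ^ n))"
  proof (rule sum.cong[OF refl])
    fix v assume v: "v \<in> X"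
    have "{w \<in> {w \<in> X. u \<bullet> w = 0}. w \<bullet> v = 0} = {w \<in> carrier_vec n. u \<bullet> w = 0 \<and> v \<bullet> w = 0}"
      using v comm_scalar_prod[of v n] unfolding X_def by auto
    then have "card {w \<in> {w \<in> X. u \<bullet> w = 0}. w \<bullet> v = 0} * CARD('q) * CARD('q) =
      (if v \<in> line u then CARD('q) ^ n * CARD('q) else CARD('q) ^ n)"
      using card_perp_pair[OF u False, of v] v unfolding X_def by simp
    then have "real (card {w \<in> {w \<in> X. u \<bullet> w = 0}. w \<bullet> v = 0} * CARD('q) * CARD('q)) =
      real (if v \<in> line u then CARD('q) ^ n * CARD('q) else CARD('q) ^ n)"
      by simp
    then show "c v * (real (card {w \<in> {w \<in> X. u \<bullet> w = 0}. w \<bullet> v = 0}) * q * q) =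
      c v * (if v \<in> line u then q ^ n * q else q ^ n)"
      unfolding q_def by (cases "v \<in> line u") simp_all
  qed
  also have "\<dots> = (\<Sum>v\<in>X. q ^ n * c v + (if v \<in> line u then (q ^ n * q - q ^ n) * c v else 0))"
    by (intro sum.cong) (auto simp: algebra_simps)
  also have "\<dots> = q ^ n * T + (\<Sum>v\<in>X. if v \<in> line u then (q ^ n * q - q ^ n) * c v else 0)"
    unfolding T_def by (simp add: sum.distrib sum_distrib_left)
  also have "(\<Sum>v\<in>X. if v \<in> line u then (q ^ n * q - q ^ n) * c v else 0)
      = (\<Sum>v\<in>line u. (q ^ n * q - q ^ n) * c v)"
    using line_subset_carrier[OF u] fX
    by (simp add: sum.inter_restrict[symmetric] X_def Int_absorb1)
  also have "\<dots> = (q ^ n * q - q ^ n) * ((q - 1) * c u)"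
    using sum_line[OF c u False] unfolding q_def by (simp add: sum_distrib_left[symmetric])
  finally have "(q ^ n * (q - 1)) * ((q - 1) * c u) = 0" using T by (simp add: algebra_simps)
  then show ?thesis using q by auto
qed (use projectiveD(1)[OF c] in simp)

section \<open>Linear embeddings\<close>

lemma card_gt_1_obtains:
  assumes "card A > 1"
  obtains x where "x \<in> A" "x \<noteq> a"
proof -
  have "\<not> A \<subseteq> {a}"
    using assms card_mono[of "{a}" A] by auto
  then show thesis using that by blast
qed

text \<open>
  Injective linear maps from \<open>\<F>\<^sub>q\<^sup>m\<close> to \<open>\<F>\<^sub>q\<^sup>n\<close>; behaviour outside \<open>carrier_vec m\<close> is unconstrained.
\<close>

definition linear_embedding :: "nat \<Rightarrow> nat \<Rightarrow> ('q::field vec \<Rightarrow> 'q vec) \<Rightarrow> bool" where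
  "linear_embedding m n M \<longleftrightarrow> M ` carrier_vec m \<subseteq> carrier_vec n \<and> inj_on M (carrier_vec m) \<and>
    (\<forall>x\<in>carrier_vec m. \<forall>y\<in>carrier_vec m. M (x + y) = M x + M y) \<and>
    (\<forall>x\<in>carrier_vec m. \<forall>t. M (t \<cdot>\<^sub>v x) = t \<cdot>\<^sub>v M x)"

lemma linear_embeddingD:
  assumes "linear_embedding m n M"
  shows "x \<in> carrier_vec m \<Longrightarrow> M x \<in> carrier_vec n" "inj_on M (carrier_vec m)"
    "x \<in> carrier_vec m \<Longrightarrow> y \<in> carrier_vec m \<Longrightarrow> M (x + y) = M x + M y"
    "x \<in> carrier_vec m \<Longrightarrow> M (t \<cdot>\<^sub>v x) = t \<cdot>\<^sub>v M x"
  using assms unfolding linear_embedding_def by auto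

lemma linear_embedding_zero:
  assumes "linear_embedding m n (M :: 'q::field vec \<Rightarrow> 'q vec)"
  shows "M (0\<^sub>v m) = 0\<^sub>v n"
proof -
  have "M (0 \<cdot>\<^sub>v 0\<^sub>v m) = 0 \<cdot>\<^sub>v M (0\<^sub>v m)"
    using linear_embeddingD[OF assms] by simp
  moreover have "0 \<cdot>\<^sub>v M (0\<^sub>v m) = 0\<^sub>v n"
    using linear_embeddingD(1)[OF assms, of "0\<^sub>v m"] by (intro eq_vecI) auto
  moreover have "0 \<cdot>\<^sub>v 0\<^sub>v m = (0\<^sub>v m :: 'q vec)" by (intro eq_vecI) auto
  ultimately show ?thesis by argo
qed

lemma grassmannian_image:
  fixes F :: "'q::{field,finite} itself"
  assumes M: "linear_embedding m n M" and V: "V \<in> grassmannian F m k"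
  shows "M ` V \<in> grassmannian F n k"
proof -
  have sub: "vec_subspace m V" and card: "card V = CARD('q) ^ k"
    using V unfolding grassmannian_iff_card by auto
  note VD = vec_subspaceD[OF sub] and MD = linear_embeddingD[OF M]
  have "vec_subspace n (M ` V)"
    unfolding vec_subspace_def
  proof (intro conjI ballI allI)
    show "0\<^sub>v n \<in> M ` V" using linear_embedding_zero[OF M] VD(2) by force
    fix u v assume "u \<in> M ` V" "v \<in> M ` V"
    then obtain x y where xy: "x \<in> V" "y \<in> V" "u = M x" "v = M y" by blast
    then have "u + v = M (x + y)" "x + y \<in> V" using VD(1,3) MD(3) by simp_all
    then show "u + v \<in> M ` V" by blast
  next
    fix v and t :: 'q assume "v \<in> M ` V"
    then obtain x where x: "x \<in> V" "v = M x" by blast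
    then have "t \<cdot>\<^sub>v v = M (t \<cdot>\<^sub>v x)" "t \<cdot>\<^sub>v x \<in> V" using VD(1,4) MD(4) by simp_all
    then show "t \<cdot>\<^sub>v v \<in> M ` V" by blast
  qed (use VD MD in auto)
  moreover have "inj_on M V"
    using MD(2) VD(1) by (meson inj_on_subset subsetI)
  ultimately show ?thesis
    using card unfolding grassmannian_iff_card by (simp add: card_image)
qed

lemma projective_comp:
  assumes "linear_embedding m n M" "projective n c"
  shows "projective m (\<lambda>x. c (M x))"
  unfolding projective_def
  using linear_embeddingD[OF assms(1)] linear_embedding_zero[OF assms(1)] projectiveD[OF assms(2)]
  by simp

lemma sum_image_linear_embedding:
  assumes "linear_embedding m n M" "vec_subspace m V"
  shows "sum c (M ` V) = (\<Sum>x\<in>V. c (M x))"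
proof -
  have "inj_on M V"
    using linear_embeddingD(2)[OF assms(1)] vec_subspaceD(1)[OF assms(2)] by (meson inj_on_subset subsetI)
  then show ?thesis by (simp add: sum.reindex)
qed

text \<open>
  Induction on \<open>k\<close>: a coordinate functional that does not vanish on \<open>V\<close> has a kernel of
  cardinality \<open>q ^ (k - 1)\<close> in \<open>V\<close>, and a parametrization of the kernel extends by one vector outside it.
\<close>

lemma vec_subspace_parametrization:
  fixes V :: "'q::{field,finite} vec set"
  assumes "vec_subspace n V" "card V = CARD('q) ^ k"
  shows "\<exists>M. linear_embedding k n M \<and> M ` carrier_vec k = V"
  using assms
proof (induction k arbitrary: V)
  case 0
  note VD = vec_subspaceD[OF 0(1)]
  obtain z where "V = {z}"
    using 0(2) by (auto simp: card_1_singleton_iff)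
  then have "V = {0\<^sub>v n}" using VD(2) by simp
  moreover have "carrier_vec 0 = {0\<^sub>v 0 :: 'q vec}" by auto
  moreover have "linear_embedding 0 n (\<lambda>_. 0\<^sub>v n :: 'q vec)"
    using calculation(2) by (auto simp: linear_embedding_def)
  ultimately show ?case
    by (intro exI[of _ "\<lambda>_. 0\<^sub>v n"]) simp
next
  case (Suc k)
  note VD = vec_subspaceD[OF Suc.prems(1)]
  have "CARD('q) ^ 0 < CARD('q) ^ Suc k"
    using card_field_ge2[where 'q='q] by (intro power_strict_increasing) auto
  then have "card V > 1" using Suc.prems(2) by simp
  then obtain x where x: "x \<in> V" "x \<noteq> 0\<^sub>v n" by (rule card_gt_1_obtains)
  obtain i where i: "i < n" "x $ i \<noteq> 0"
    using nonzero_vec_coordinate[OF VD(1)[OF x(1)] x(2)] .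
  let ?K = "{v \<in> V. unit_vec n i \<bullet> v = 0}"
  have "unit_vec n i \<bullet> x \<noteq> 0" using i VD(1)[OF x(1)] by simp
  then have "card ?K * CARD('q) = CARD('q) ^ Suc k"
    using card_kernel[OF Suc.prems(1) _ x(1)] Suc.prems(2) by simp
  then have "card ?K = CARD('q) ^ k" by simp
  then obtain M where M: "linear_embedding k n M" "M ` carrier_vec k = ?K"
    using Suc.IH[OF vec_subspace_kernel[OF Suc.prems(1) unit_vec_carrier]] by blast
  note MD = linear_embeddingD[OF M(1)]
  define tr where "tr y = vec k (\<lambda>j. y $ j)" for y :: "'q vec"
  have tr: "tr y \<in> carrier_vec k" for y unfolding tr_def by simp
  define N where "N y = M (tr y) + y $ k \<cdot>\<^sub>v x" for y
  have xc: "x \<in> carrier_vec n" using VD(1) x by simp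
  have NV: "N y \<in> V" for y
  proof -
    have "M (tr y) \<in> V" using M(2) tr[of y] by blast
    then show ?thesis unfolding N_def using VD x by simp
  qed
  have Ni: "N y $ i = y $ k * x $ i" for y
  proof -
    have "M (tr y) \<in> ?K" using M(2) tr[of y] by blast
    then have "M (tr y) $ i = 0" using scalar_prod_left_unit[OF MD(1)[OF tr] i(1)] by simp
    then show ?thesis unfolding N_def using i xc MD(1)[OF tr] by simp
  qed
  have inj: "inj_on N (carrier_vec (Suc k))"
  proof (rule inj_onI)
    fix y z :: "'q vec" assume yz: "y \<in> carrier_vec (Suc k)" "z \<in> carrier_vec (Suc k)" "N y = N z"
    have k: "y $ k = z $ k" using Ni[of y] Ni[of z] yz(3) i by simp
    have "M (tr y) = M (tr z)"
    proof (rule eq_vecI)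
      show "dim_vec (M (tr y)) = dim_vec (M (tr z))"
        using MD(1)[OF tr, of y] MD(1)[OF tr, of z] by simp
      fix j assume "j < dim_vec (M (tr z))"
      then have "j < n" using MD(1)[OF tr, of z] by simp
      then show "M (tr y) $ j = M (tr z) $ j"
        using arg_cong[OF yz(3), of "\<lambda>v. v $ j"] k xc MD(1)[OF tr]
        unfolding N_def by simp
    qed
    then have eq: "tr y = tr z" by (rule inj_onD[OF MD(2) _ tr tr])
    show "y = z"
    proof (rule eq_vecI)
      fix j assume "j < dim_vec z"
      then have "j < k \<or> j = k" using yz(2) by auto
      then show "y $ j = z $ j"
        using k arg_cong[OF eq, of "\<lambda>v. v $ j"] unfolding tr_def by auto
    qed (use yz in auto)
  qed
  have "linear_embedding (Suc k) n N"
    unfolding linear_embedding_def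
  proof (intro conjI ballI allI)
    show "N ` carrier_vec (Suc k) \<subseteq> carrier_vec n" using NV VD(1) by blast
    fix y z :: "'q vec" assume yz: "y \<in> carrier_vec (Suc k)" "z \<in> carrier_vec (Suc k)"
    have "tr (y + z) = tr y + tr z" unfolding tr_def using yz by (intro eq_vecI) auto
    then have "M (tr (y + z)) = M (tr y) + M (tr z)" using MD(3)[OF tr tr] by simp
    then show "N (y + z) = N y + N z"
      unfolding N_def using yz xc MD(1)[OF tr, of y] MD(1)[OF tr, of z]
      by (intro eq_vecI) (auto simp: algebra_simps)
  next
    fix y :: "'q vec" and t assume y: "y \<in> carrier_vec (Suc k)"
    have "tr (t \<cdot>\<^sub>v y) = t \<cdot>\<^sub>v tr y" unfolding tr_def using y by (intro eq_vecI) auto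
    then have "M (tr (t \<cdot>\<^sub>v y)) = t \<cdot>\<^sub>v M (tr y)" using MD(4)[OF tr] by simp
    then show "N (t \<cdot>\<^sub>v y) = t \<cdot>\<^sub>v N y"
      unfolding N_def using y xc MD(1)[OF tr, of y]
      by (intro eq_vecI) (auto simp: algebra_simps)
  qed (rule inj)
  moreover have "N ` carrier_vec (Suc k) = V"
  proof (rule card_subset_eq)
    show "card (N ` carrier_vec (Suc k)) = card V"
      using Suc.prems(2) by (simp add: card_image[OF inj] card_carrier_vec)
  qed (use NV vec_subspace_finite[OF Suc.prems(1)] in auto)
  ultimately show ?case by blast
qed

text \<open>
  Three linear conditions on a vector of length at least \<open>4\<close> have a nonzero solution \<open>w\<close>; the
  embedding parametrizes the hyperplane orthogonal to \<open>w\<close>.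
\<close>

lemma hyperplane_through_three:
  fixes u v x :: "'q::{field,finite} vec"
  assumes n: "n \<ge> 3" and uvx: "u \<in> carrier_vec (Suc n)" "v \<in> carrier_vec (Suc n)" "x \<in> carrier_vec (Suc n)"
  obtains M where "linear_embedding n (Suc n) M" "{u, v, x} \<subseteq> M ` carrier_vec n"
proof -
  let ?q = "CARD('q)"
  let ?A = "{w \<in> carrier_vec (Suc n). u \<bullet> w = 0}"
  let ?B = "{w \<in> ?A. v \<bullet> w = 0}"
  let ?C = "{w \<in> ?B. x \<bullet> w = 0}"
  have A: "vec_subspace (Suc n) ?A" by (rule vec_subspace_kernel[OF vec_subspace_carrier uvx(1)])
  have B: "vec_subspace (Suc n) ?B" by (rule vec_subspace_kernel[OF A uvx(2)])
  have q: "?q \<ge> 2" by (rule card_field_ge2)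
  have "?q ^ Suc n \<le> card ?A * ?q"
    using card_le_card_kernel[OF vec_subspace_carrier uvx(1)] by (simp add: card_carrier_vec)
  also have "\<dots> \<le> card ?B * ?q * ?q"
    using card_le_card_kernel[OF A uvx(2)] by (rule mult_right_mono) simp
  also have "\<dots> \<le> card ?C * ?q * ?q * ?q"
    using card_le_card_kernel[OF B uvx(3)] by (intro mult_right_mono) simp_all
  finally have "?q ^ Suc n \<le> card ?C * ?q ^ 3" by (simp add: power3_eq_cube mult.assoc)
  moreover have "?q ^ 3 < ?q ^ Suc n" by (rule power_strict_increasing) (use q n in auto)
  ultimately have "1 * ?q ^ 3 < card ?C * ?q ^ 3" by linarith
  then have "card ?C > 1" unfolding mult_less_cancel2 by blast
  then obtain w where w: "w \<in> ?C" "w \<noteq> 0\<^sub>v (Suc n)" by (rule card_gt_1_obtains)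
  let ?H = "{y \<in> carrier_vec (Suc n). w \<bullet> y = 0}"
  have wc: "w \<in> carrier_vec (Suc n)" using w by simp
  have "card ?H = ?q ^ n" using card_perp[OF wc w(2)] by simp
  then obtain M where M: "linear_embedding n (Suc n) M" "M ` carrier_vec n = ?H"
    using vec_subspace_parametrization[OF vec_subspace_kernel[OF vec_subspace_carrier wc]] by blast
  have "{u, v, x} \<subseteq> ?H"
    using w(1) uvx comm_scalar_prod[OF wc] by simp
  then show thesis using that M by simp
qed

section \<open>Uniqueness of the coefficients\<close>

text \<open>
  The functions \<open>x\<^sub>p\<close> on \<open>J\<^sub>q(n,k)\<close> are linearly independent for \<open>2 \<le> k < n\<close>. The case \<open>n = k + 1\<close> is the
  one of hyperplanes, and larger \<open>n\<close> follow by restriction to hyperplanes.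
\<close>

lemma projective_zero_if_sums_zero:
  fixes F :: "'q::{field,finite} itself" and c :: "'q vec \<Rightarrow> real"
  assumes "2 \<le> k" "k < n" "projective n c"
    and "\<And>V. V \<in> grassmannian F n k \<Longrightarrow> sum c V = 0"
    and "v \<in> carrier_vec n"
  shows "c v = 0"
proof -
  have "Suc k \<le> n" using assms by simp
  then show ?thesis using assms(3-)
  proof (induction n arbitrary: c v rule: dec_induct)
    case base
    have "(\<Sum>v | v \<in> carrier_vec (Suc k) \<and> w \<bullet> v = 0. c v) = 0"
      if w: "w \<in> carrier_vec (Suc k)" "w \<noteq> 0\<^sub>v (Suc k)" for w
      using card_perp[OF w] vec_subspace_kernel[OF vec_subspace_carrier w(1)]
      by (intro base(2)) (simp add: grassmannian_iff_card)
    then show ?case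
      using projective_zero_if_hyperplane_sums_zero[OF _ base(1) _ base(3)] assms(1) by simp
  next
    case (step n)
    obtain M where M: "linear_embedding n (Suc n) M" "v \<in> M ` carrier_vec n"
      using hyperplane_through_three[of n v v v] step.hyps assms(1) step.prems by auto
    then obtain x where x: "x \<in> carrier_vec n" "v = M x" by blast
    have "c (M x) = 0"
    proof (rule step.IH[OF projective_comp[OF M(1) step.prems(1)] _ x(1)])
      fix V assume V: "V \<in> grassmannian F n k"
      then show "(\<Sum>x\<in>V. c (M x)) = 0"
        using sum_image_linear_embedding[OF M(1), of V c]
          step.prems(2)[OF grassmannian_image[OF M(1) V]]
        by (simp add: grassmannian_iff_card)
    qed
    then show ?case using x by simp
  qed
qed

section \<open>Points and degree one functions\<close>

lemma mem_line: "t \<cdot>\<^sub>v u \<in> line u" "u \<in> line u" for u :: "'q::field vec"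
  unfolding line_def by (auto intro: range_eqI[of _ _ 1])

lemma smult_vec_eq_zero_iff:
  fixes v :: "'q::field vec"
  assumes "v \<in> carrier_vec n" "t \<noteq> 0"
  shows "t \<cdot>\<^sub>v v = 0\<^sub>v n \<longleftrightarrow> v = 0\<^sub>v n"
  using assms smult_vec_eq_zero by (cases "v = 0\<^sub>v n") auto

lemma line_smult:
  fixes u :: "'q::field vec"
  assumes "t \<noteq> 0"
  shows "line (t \<cdot>\<^sub>v u) = line u"
proof -
  have "line (t \<cdot>\<^sub>v u) = (\<lambda>s. (s * t) \<cdot>\<^sub>v u) ` UNIV"
    unfolding line_def by (simp add: smult_smult_assoc)
  also have "\<dots> = (\<lambda>s. s \<cdot>\<^sub>v u) ` (\<lambda>s. s * t) ` UNIV"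
    by (simp add: image_image)
  also have "(\<lambda>s. s * t) ` UNIV = UNIV"
    using assms by (intro surjI[of _ "\<lambda>s. s / t"]) simp
  finally show ?thesis unfolding line_def .
qed

lemma line_eq_if_mem:
  fixes u :: "'q::field vec"
  assumes u: "u \<in> carrier_vec n" and v: "v \<in> line u" "v \<noteq> 0\<^sub>v n"
  shows "line v = line u"
proof -
  obtain t where t: "v = t \<cdot>\<^sub>v u" using v(1) unfolding line_def by auto
  then have "t \<noteq> 0" using v(2) u by auto
  then show ?thesis unfolding t by (rule line_smult)
qed

lemma vec_subspace_line:
  assumes "u \<in> carrier_vec n"
  shows "vec_subspace n (line u)"
  unfolding vec_subspace_def
proof (intro conjI ballI allI)
  have "0 \<cdot>\<^sub>v u = 0\<^sub>v n" using assms by auto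
  then show "0\<^sub>v n \<in> line u" using mem_line(1)[of 0 u] by simp
  fix v w assume "v \<in> line u" "w \<in> line u"
  then obtain s t where "v = s \<cdot>\<^sub>v u" "w = t \<cdot>\<^sub>v u" unfolding line_def by auto
  then have "v + w = (s + t) \<cdot>\<^sub>v u" by (simp add: add_smult_distrib_vec)
  then show "v + w \<in> line u" using mem_line(1) by simp
next
  fix t v assume "v \<in> line u"
  then obtain s where "v = s \<cdot>\<^sub>v u" unfolding line_def by auto
  then have "t \<cdot>\<^sub>v v = (t * s) \<cdot>\<^sub>v u" by (simp add: smult_smult_assoc)
  then show "t \<cdot>\<^sub>v v \<in> line u" using mem_line(1) by simp
qed (use line_subset_carrier[OF assms] in auto)

lemma card_line:
  fixes u :: "'q::{field,finite} vec"
  assumes "u \<in> carrier_vec n" "u \<noteq> 0\<^sub>v n"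
  shows "card (line u) = CARD('q)"
  unfolding line_def using inj_smult_vec[OF assms] by (simp add: card_image)

lemma line_subset_iff:
  assumes "vec_subspace n V"
  shows "line u \<subseteq> V \<longleftrightarrow> u \<in> V"
  using vec_subspaceD(4)[OF assms] mem_line(2)[of u] unfolding line_def by blast

lemma points_eq_lines: "points F n = line ` (carrier_vec n - {0\<^sub>v n})"
  for F :: "'q::{field,finite} itself"
proof (intro equalityI subsetI)
  fix p assume "p \<in> points F n"
  then have p: "vec_subspace n p" "card p = CARD('q)"
    unfolding grassmannian_iff_card by auto
  then have "card p > 1" using card_field_ge2[where 'q='q] by simp
  then obtain u where u: "u \<in> p" "u \<noteq> 0\<^sub>v n" by (rule card_gt_1_obtains)
  have uc: "u \<in> carrier_vec n" using vec_subspaceD(1)[OF p(1)] u by simp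
  have "line u = p"
    using line_subset_iff[OF p(1)] u card_line[OF uc u(2)] p
    by (intro card_subset_eq vec_subspace_finite) auto
  then show "p \<in> line ` (carrier_vec n - {0\<^sub>v n})" using u uc by blast
next
  fix p :: "'q vec set" assume "p \<in> line ` (carrier_vec n - {0\<^sub>v n})"
  then show "p \<in> points F n"
    unfolding grassmannian_iff_card using vec_subspace_line card_line by auto
qed

lemma orthogonal_lines_iff:
  fixes p r :: "'q::{field,finite} vec"
  assumes "p \<in> carrier_vec n" "r \<in> carrier_vec n"
  shows "orthogonal_spaces (line p) (line r) \<longleftrightarrow> r \<bullet> p = 0"
proof
  assume "orthogonal_spaces (line p) (line r)"
  then have "p \<bullet> r = 0" unfolding orthogonal_spaces_def using mem_line(2) by blast
  then show "r \<bullet> p = 0" using comm_scalar_prod assms by metis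
next
  assume "r \<bullet> p = 0"
  then have "p \<bullet> r = 0" using comm_scalar_prod assms by metis
  then show "orthogonal_spaces (line p) (line r)"
    unfolding orthogonal_spaces_def line_def using assms by auto
qed

lemma y_fun_line:
  assumes V: "vec_subspace n V" and r: "r \<in> carrier_vec n"
  shows "y_fun (line r) V = (if \<forall>v\<in>V. r \<bullet> v = 0 then 1 else 0)"
proof -
  have "orthogonal_spaces V (line r) \<longleftrightarrow> (\<forall>v\<in>V. v \<bullet> r = 0)"
    unfolding orthogonal_spaces_def line_def using vec_subspaceD(1)[OF V] r mem_line(2)[of r]
    by (auto intro: range_eqI[of _ _ 1])
  also have "\<dots> \<longleftrightarrow> (\<forall>v\<in>V. r \<bullet> v = 0)"
    using vec_subspaceD(1)[OF V] comm_scalar_prod[OF r] by simp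
  finally show ?thesis unfolding y_fun_def by simp
qed

lemma x_fun_line:
  assumes "vec_subspace n V"
  shows "x_fun (line p) V = (if p \<in> V then 1 else 0)"
  unfolding x_fun_def line_subset_iff[OF assms] ..

text \<open>
  The nonzero vectors of \<open>V\<close> are partitioned by the points contained in \<open>V\<close>.
\<close>

lemma sum_points:
  fixes F :: "'q::{field,finite} itself" and C :: "'q vec set \<Rightarrow> real"
  assumes V: "vec_subspace n V"
  shows "(\<Sum>p\<in>points F n. C p * x_fun p V) = (\<Sum>v\<in>V - {0\<^sub>v n}. C (line v) / (real CARD('q) - 1))"
proof -
  note VD = vec_subspaceD[OF V]
  let ?S = "V - {0\<^sub>v n}"
  have fS: "finite ?S" using vec_subspace_finite[OF V] by simp
  have img: "line ` ?S = {p \<in> points F n. p \<subseteq> V}"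
    unfolding points_eq_lines using line_subset_iff[OF V] VD(1) by auto
  have "(\<Sum>v\<in>?S. C (line v) / (real CARD('q) - 1)) =
      (\<Sum>p\<in>line ` ?S. \<Sum>v | v \<in> ?S \<and> line v = p. C (line v) / (real CARD('q) - 1))"
    by (rule sum.image_gen[OF fS])
  also have "\<dots> = (\<Sum>p\<in>line ` ?S. C p)"
  proof (rule sum.cong[OF refl])
    fix p assume "p \<in> line ` ?S"
    then obtain u where u: "u \<in> V" "u \<noteq> 0\<^sub>v n" "p = line u" by auto
    have uc: "u \<in> carrier_vec n" using u VD by simp
    have "{v. v \<in> ?S \<and> line v = p} = line u - {0\<^sub>v n}"
      using line_eq_if_mem[OF uc] mem_line(2) line_subset_iff[OF V] u by blast
    moreover have "card (line u - {0\<^sub>v n}) = CARD('q) - 1"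
      using card_line[OF uc u(2)] vec_subspaceD(2)[OF vec_subspace_line[OF uc]]
      by (simp add: card_Diff_singleton)
    moreover have "(\<Sum>v | v \<in> ?S \<and> line v = p. C (line v) / (real CARD('q) - 1)) =
      (\<Sum>v | v \<in> ?S \<and> line v = p. C p / (real CARD('q) - 1))"
      by (rule sum.cong) auto
    ultimately show "(\<Sum>v | v \<in> ?S \<and> line v = p. C (line v) / (real CARD('q) - 1)) = C p"
      using card_field_ge2[where 'q='q] by (simp add: of_nat_diff)
  qed
  also have "\<dots> = (\<Sum>p\<in>points F n. if p \<subseteq> V then C p else 0)"
    unfolding img by (rule sum.inter_filter) (rule finite_grassmannian)
  also have "\<dots> = (\<Sum>p\<in>points F n. C p * x_fun p V)"
    unfolding x_fun_def by (intro sum.cong) auto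
  finally show ?thesis ..
qed

lemma degree_one_iff_projective:
  fixes F :: "'q::{field,finite} itself"
  shows "degree_one F n k f \<longleftrightarrow> (\<exists>c. projective n c \<and> (\<forall>V\<in>grassmannian F n k. f V = sum c V))"
proof
  assume "degree_one F n k f"
  then obtain C where C: "\<And>V. V \<in> grassmannian F n k \<Longrightarrow> f V = (\<Sum>p\<in>points F n. C p * x_fun p V)"
    unfolding degree_one_def by blast
  define c where "c v = (if v = 0\<^sub>v n then 0 else C (line v) / (real CARD('q) - 1))" for v
  have "projective n c"
    unfolding projective_def c_def by (simp add: line_smult smult_vec_eq_zero_iff)
  moreover have "f V = sum c V" if V: "V \<in> grassmannian F n k" for V
  proof -
    have sub: "vec_subspace n V" using V unfolding grassmannian_iff_card by simp
    have "f V = (\<Sum>v\<in>V - {0\<^sub>v n}. C (line v) / (real CARD('q) - 1))"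
      unfolding C[OF V] by (rule sum_points[OF sub])
    also have "\<dots> = sum c (V - {0\<^sub>v n})" unfolding c_def by (intro sum.cong) auto
    also have "\<dots> = sum c V"
      using vec_subspace_finite[OF sub] vec_subspaceD(2)[OF sub]
      by (simp add: sum.remove[of V "0\<^sub>v n"] c_def)
    finally show ?thesis .
  qed
  ultimately show "\<exists>c. projective n c \<and> (\<forall>V\<in>grassmannian F n k. f V = sum c V)" by blast
next
  assume "\<exists>c. projective n c \<and> (\<forall>V\<in>grassmannian F n k. f V = sum c V)"
  then obtain c where c: "projective n c" and f: "\<And>V. V \<in> grassmannian F n k \<Longrightarrow> f V = sum c V"
    by blast
  have "f V = (\<Sum>p\<in>points F n. sum c p * x_fun p V)" if V: "V \<in> grassmannian F n k" for V
  proof -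
    have sub: "vec_subspace n V" using V unfolding grassmannian_iff_card by simp
    have "(\<Sum>p\<in>points F n. sum c p * x_fun p V) =
        (\<Sum>v\<in>V - {0\<^sub>v n}. sum c (line v) / (real CARD('q) - 1))"
      by (rule sum_points[OF sub])
    also have "\<dots> = sum c (V - {0\<^sub>v n})"
      using sum_line[OF c] vec_subspaceD(1)[OF sub] card_field_ge2[where 'q='q]
      by (intro sum.cong) auto
    also have "\<dots> = sum c V"
      using vec_subspace_finite[OF sub] vec_subspaceD(2)[OF sub] projectiveD(1)[OF c]
      by (simp add: sum.remove[of V "0\<^sub>v n"])
    finally show ?thesis using f[OF V] by simp
  qed
  then show "degree_one F n k f" unfolding degree_one_def by blast
qed

section \<open>Coefficients of the trivial functions\<close>

text \<open>
  The value, on the vectors where it is supported, of the coefficient function of \<open>x\<^sub>p\<close> (supported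
  on \<open>p\<close>), of \<open>1 - y\<^sub>r\<close> (supported off the hyperplane orthogonal to \<open>r\<close>), and of the constant \<open>1\<close>.
  The denominators are the numbers of vectors of \<open>V\<close> in the support when the function is \<open>1\<close> at \<open>V\<close>.
\<close>

definition point_weight :: "real \<Rightarrow> real" where
  "point_weight q = 1 / (q - 1)"

definition hyperplane_weight :: "real \<Rightarrow> nat \<Rightarrow> real" where
  "hyperplane_weight q k = 1 / (q ^ k - q ^ (k - 1))"

definition one_weight :: "real \<Rightarrow> nat \<Rightarrow> real" where
  "one_weight q k = 1 / (q ^ k - 1)"

lemma weights_ineq:
  assumes "q \<ge> 2" "k \<ge> 2"
  shows "0 < one_weight q k" "one_weight q k < hyperplane_weight q k"
    "2 * hyperplane_weight q k \<le> point_weight q"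
proof -
  obtain j where k: "k = Suc j" "j \<ge> 1" using assms(2) by (cases k) auto
  have "q ^ 1 \<le> q ^ j" using assms k by (intro power_increasing) auto
  then have j: "q ^ j \<ge> 2" using assms by simp
  have "q ^ j * 1 < q ^ j * q" using j assms by (intro mult_strict_left_mono) auto
  then have pos: "q ^ k - q ^ (k - 1) > 0" using k by (simp add: mult.commute)
  have "2 * 2 \<le> q * q ^ j" using j assms by (intro mult_mono) auto
  then have "q ^ k > 1" using k by simp
  then show "0 < one_weight q k" "one_weight q k < hyperplane_weight q k"
    using pos j k unfolding one_weight_def hyperplane_weight_def
    by (auto intro!: divide_strict_left_mono mult_pos_pos)
  have "hyperplane_weight q k = 1 / q ^ j * point_weight q"
    using k unfolding hyperplane_weight_def point_weight_def by (simp add: algebra_simps)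
  moreover have "1 / q ^ j \<le> 1 / 2" using j by (intro divide_left_mono) auto
  moreover have "point_weight q > 0" using assms unfolding point_weight_def by simp
  ultimately have "hyperplane_weight q k \<le> 1 / 2 * point_weight q"
    by (metis mult_right_mono less_imp_le)
  then show "2 * hyperplane_weight q k \<le> point_weight q" by simp
qed

text \<open>
  The coefficients of the four functions \<open>0\<close>, \<open>x\<^sub>p\<close>, \<open>1 - y\<^sub>w\<close> and \<open>1 - x\<^sub>p - y\<^sub>w\<close>, where the vectors
  \<open>p\<close> and \<open>w\<close> stand for the points that they span. A zero vector \<open>p\<close> means that the term \<open>x\<^sub>p\<close> is
  absent, and a zero vector \<open>w\<close> that the term \<open>1 - y\<^sub>w\<close> is absent.
\<close>

definition std_coeff :: "nat \<Rightarrow> nat \<Rightarrow> 'q::{field,finite} vec \<Rightarrow> 'q vec \<Rightarrow> 'q vec \<Rightarrow> real" where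
  "std_coeff n k p w v =
    (if w \<bullet> v \<noteq> 0 then hyperplane_weight (real CARD('q)) k else 0) +
    (if v \<noteq> 0\<^sub>v n \<and> v \<in> line p then (if w = 0\<^sub>v n then 1 else - 1) * point_weight (real CARD('q)) else 0)"

text \<open>
  The coefficients of the constant function \<open>1\<close>.
\<close>

definition one_coeff :: "nat \<Rightarrow> nat \<Rightarrow> 'q::{field,finite} vec \<Rightarrow> real" where
  "one_coeff n k v = (if v = 0\<^sub>v n then 0 else one_weight (real CARD('q)) k)"

text \<open>
  The condition on \<open>p\<close> and \<open>w\<close> in the definition of a trivial function: if both are nonzero, the points
  that they span are not orthogonal.
\<close>

definition admissible :: "nat \<Rightarrow> 'q::field vec \<Rightarrow> 'q vec \<Rightarrow> bool" where
  "admissible n p w \<longleftrightarrow> p \<in> carrier_vec n \<and> w \<in> carrier_vec n \<and>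
    (w = 0\<^sub>v n \<or> p = 0\<^sub>v n \<or> w \<bullet> p \<noteq> 0)"

lemma projective_one_coeff: "projective n (one_coeff n k)"
  unfolding projective_def one_coeff_def by (simp add: smult_vec_eq_zero_iff)

lemma projective_std_coeff:
  assumes "w \<in> carrier_vec n" "p \<in> carrier_vec n"
  shows "projective n (std_coeff n k p w)"
proof -
  have "t \<cdot>\<^sub>v v \<noteq> 0\<^sub>v n \<and> t \<cdot>\<^sub>v v \<in> line p \<longleftrightarrow> v \<noteq> 0\<^sub>v n \<and> v \<in> line p"
    if "t \<noteq> 0" "v \<in> carrier_vec n" for t v
    using smult_vec_eq_zero_iff[OF that(2,1)] line_smult[OF that(1), of v]
      line_subset_iff[OF vec_subspace_line[OF assms(2)], of v]
      line_subset_iff[OF vec_subspace_line[OF assms(2)], of "t \<cdot>\<^sub>v v"] by simp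
  then show ?thesis
    using assms unfolding projective_def std_coeff_def by simp
qed

lemma projective_diff:
  "projective n c \<Longrightarrow> projective n d \<Longrightarrow> projective n (\<lambda>v. c v - d v)"
  unfolding projective_def by auto

lemma sum_one_coeff:
  fixes F :: "'q::{field,finite} itself"
  assumes V: "V \<in> grassmannian F n k" and k: "k \<ge> 2"
  shows "sum (one_coeff n k) V = 1"
proof -
  have sub: "vec_subspace n V" and card: "card V = CARD('q) ^ k"
    using V unfolding grassmannian_iff_card by auto
  have fV: "finite V" by (rule vec_subspace_finite[OF sub])
  let ?q = "real CARD('q)"
  have q: "?q \<ge> 2" using card_field_ge2[where 'q='q] by linarith
  have "sum (one_coeff n k) V = sum (one_coeff n k) (V - {0\<^sub>v n})"
    using fV vec_subspaceD(2)[OF sub] by (simp add: sum.remove[of V "0\<^sub>v n"] one_coeff_def)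
  also have "\<dots> = (\<Sum>v\<in>V - {0\<^sub>v n}. one_weight ?q k)"
    by (intro sum.cong) (auto simp: one_coeff_def)
  also have "\<dots> = (?q ^ k - 1) * one_weight ?q k"
    using card vec_subspaceD(2)[OF sub] by (simp add: card_Diff_singleton of_nat_diff)
  finally show ?thesis
    using weights_ineq(1)[OF q k] unfolding one_weight_def by simp
qed

lemma sum_std_coeff:
  fixes F :: "'q::{field,finite} itself"
  assumes V: "V \<in> grassmannian F n k" and k: "k \<ge> 2"
    and p: "p \<in> carrier_vec n" and w: "w \<in> carrier_vec n"
  shows "sum (std_coeff n k p w) V = 1 - y_fun (line w) V +
    (if p = 0\<^sub>v n then 0 else (if w = 0\<^sub>v n then 1 else - 1) * x_fun (line p) V)"
proof -
  have sub: "vec_subspace n V" and card: "card V = CARD('q) ^ k"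
    using V unfolding grassmannian_iff_card by auto
  have fV: "finite V" by (rule vec_subspace_finite[OF sub])
  let ?q = "real CARD('q)"
  have q: "?q \<ge> 2" using card_field_ge2[where 'q='q] by linarith
  have hyp: "(\<Sum>v\<in>V. if w \<bullet> v \<noteq> 0 then hyperplane_weight ?q k else 0) = 1 - y_fun (line w) V"
  proof (cases "\<forall>v\<in>V. w \<bullet> v = 0")
    case True
    then show ?thesis by (simp add: y_fun_line[OF sub w])
  next
    case False
    then obtain x where "x \<in> V" "w \<bullet> x \<noteq> 0" by blast
    then have K: "card {v \<in> V. w \<bullet> v = 0} * CARD('q) = CARD('q) ^ k"
      using card_kernel[OF sub w] card by simp
    obtain j where j: "k = Suc j" using k by (cases k) auto
    have "card {v \<in> V. w \<bullet> v = 0} = CARD('q) ^ (k - 1)" using K j by simp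
    moreover have "{v \<in> V. w \<bullet> v \<noteq> 0} = V - {v \<in> V. w \<bullet> v = 0}" by auto
    moreover have "CARD('q) ^ (k - 1) \<le> CARD('q) ^ k"
      using card_field_ge2[where 'q='q] by (intro power_increasing) auto
    ultimately have "real (card {v \<in> V. w \<bullet> v \<noteq> 0}) = ?q ^ k - ?q ^ (k - 1)"
      using fV card by (simp add: card_Diff_subset of_nat_diff)
    moreover have "?q ^ k - ?q ^ (k - 1) \<noteq> 0"
      using weights_ineq(1,2)[OF q k] unfolding hyperplane_weight_def by force
    ultimately show ?thesis
      using False fV
      by (simp add: y_fun_line[OF sub w] sum.inter_filter[symmetric] hyperplane_weight_def)
  qed
  have pt: "(\<Sum>v\<in>V. if v \<noteq> 0\<^sub>v n \<and> v \<in> line p then s * point_weight ?q else 0) =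
      (if p = 0\<^sub>v n then 0 else s * x_fun (line p) V)" for s
  proof -
    have *: "(\<Sum>v\<in>V. if v \<noteq> 0\<^sub>v n \<and> v \<in> line p then s * point_weight ?q else 0) =
        real (card {v \<in> V. v \<noteq> 0\<^sub>v n \<and> v \<in> line p}) * (s * point_weight ?q)"
      using fV by (simp add: sum.inter_filter[symmetric])
    have sp: "vec_subspace n (line p)" by (rule vec_subspace_line[OF p])
    show ?thesis
    proof (cases "p \<noteq> 0\<^sub>v n \<and> p \<in> V")
      case True
      then have "{v \<in> V. v \<noteq> 0\<^sub>v n \<and> v \<in> line p} = line p - {0\<^sub>v n}"
        using line_subset_iff[OF sub, of p] by blast
      moreover have "card (line p - {0\<^sub>v n}) = CARD('q) - 1"
        using card_line[OF p] True vec_subspaceD(2)[OF sp] by (simp add: card_Diff_singleton)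
      ultimately show ?thesis
        unfolding * using True q x_fun_line[OF sub, of p]
        by (simp add: of_nat_diff point_weight_def)
    next
      case False
      have "\<not> (v \<in> V \<and> v \<noteq> 0\<^sub>v n \<and> v \<in> line p)" for v
      proof
        assume v: "v \<in> V \<and> v \<noteq> 0\<^sub>v n \<and> v \<in> line p"
        then have "line v = line p" using line_eq_if_mem[OF p] by blast
        then have "p \<in> V" using v line_subset_iff[OF sub] by metis
        then have "p = 0\<^sub>v n" using False by simp
        then have "line p \<subseteq> {0\<^sub>v n}" unfolding line_def by auto
        then show False using v by blast
      qed
      then have "{v \<in> V. v \<noteq> 0\<^sub>v n \<and> v \<in> line p} = {}" by blast
      then have "card {v \<in> V. v \<noteq> 0\<^sub>v n \<and> v \<in> line p} = 0" by (simp only: card.empty)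
      then have "(\<Sum>v\<in>V. if v \<noteq> 0\<^sub>v n \<and> v \<in> line p then s * point_weight ?q else 0) = 0"
        unfolding * by (simp only: of_nat_0 mult_zero_left)
      moreover have "(if p = 0\<^sub>v n then 0 else s * x_fun (line p) V) = 0"
        using False x_fun_line[OF sub, of p] by auto
      ultimately show ?thesis by (simp only:)
    qed
  qed
  show ?thesis
    unfolding std_coeff_def sum.distrib hyp pt ..
qed

text \<open>
  The four of the eight trivial functions that are of the form \<open>0\<close>, \<open>x\<^sub>p\<close>, \<open>1 - y\<^sub>r\<close> or
  \<open>1 - x\<^sub>p - y\<^sub>r\<close>. The other four are the complements \<open>1 - f\<close> of these.
\<close>

definition std_function :: "'q::{field,finite} itself \<Rightarrow> nat \<Rightarrow> nat \<Rightarrow> ('q vec set \<Rightarrow> real) \<Rightarrow> bool" where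
  "std_function F n k f \<longleftrightarrow>
    (\<exists>p w. admissible n p w \<and> (\<forall>V\<in>grassmannian F n k. f V = sum (std_coeff n k p w) V))"

lemma std_function_iff:
  fixes F :: "'q::{field,finite} itself"
  assumes k: "k \<ge> 2"
  shows "std_function F n k f \<longleftrightarrow>
    (let eq = equal_on (grassmannian F n k) f in
      eq (\<lambda>V. 0) \<or>
      (\<exists>p\<in>points F n. eq (\<lambda>V. x_fun p V)) \<or>
      (\<exists>r\<in>points F n. eq (\<lambda>V. 1 - y_fun r V)) \<or>
      (\<exists>p\<in>points F n. \<exists>r\<in>points F n. \<not> orthogonal_spaces p r \<and>
        eq (\<lambda>V. 1 - x_fun p V - y_fun r V)))" (is "_ \<longleftrightarrow> ?R")
proof -
  let ?z = "0\<^sub>v n :: 'q vec"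
  let ?G = "grassmannian F n k"
  have y0: "y_fun (line ?z) V = 1" if "V \<in> ?G" for V
  proof -
    have V: "vec_subspace n V" using that unfolding grassmannian_iff_card by simp
    then show ?thesis using y_fun_line[OF V, of ?z] vec_subspaceD(1)[OF V] by simp
  qed
  show ?thesis
  proof
    assume "std_function F n k f"
    then obtain p w where pw: "p \<in> carrier_vec n" "w \<in> carrier_vec n"
      and adm: "w = ?z \<or> p = ?z \<or> w \<bullet> p \<noteq> 0"
      and f: "\<And>V. V \<in> ?G \<Longrightarrow> f V = 1 - y_fun (line w) V +
        (if p = ?z then 0 else (if w = ?z then 1 else - 1) * x_fun (line p) V)"
      unfolding std_function_def admissible_def using sum_std_coeff[OF _ k] by (metis (no_types, lifting))
    have lp: "line p \<in> points F n" if "p \<noteq> ?z" using that pw unfolding points_eq_lines by blast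
    have lw: "line w \<in> points F n" if "w \<noteq> ?z" using that pw unfolding points_eq_lines by blast
    consider "w = ?z" "p = ?z" | "w = ?z" "p \<noteq> ?z" | "w \<noteq> ?z" "p = ?z" | "w \<noteq> ?z" "p \<noteq> ?z"
      by blast
    then show ?R
    proof cases
      case 1
      then have "equal_on ?G f (\<lambda>V. 0)" using f y0 unfolding equal_on_def by simp
      then show ?thesis unfolding Let_def by blast
    next
      case 2
      then have "equal_on ?G f (\<lambda>V. x_fun (line p) V)" using f y0 unfolding equal_on_def by simp
      then show ?thesis using lp[OF 2(2)] unfolding Let_def by blast
    next
      case 3
      then have "equal_on ?G f (\<lambda>V. 1 - y_fun (line w) V)" using f unfolding equal_on_def by simp
      then show ?thesis using lw[OF 3(1)] unfolding Let_def by blast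
    next
      case 4
      then have "equal_on ?G f (\<lambda>V. 1 - x_fun (line p) V - y_fun (line w) V)"
        using f unfolding equal_on_def by simp
      moreover have "\<not> orthogonal_spaces (line p) (line w)"
        using orthogonal_lines_iff[OF pw] adm 4 by blast
      ultimately show ?thesis using lp[OF 4(2)] lw[OF 4(1)] unfolding Let_def by blast
    qed
  next
    have intro: "std_function F n k f" if "admissible n p w"
      "\<And>V. V \<in> ?G \<Longrightarrow> f V = 1 - y_fun (line w) V +
        (if p = ?z then 0 else (if w = ?z then 1 else - 1) * x_fun (line p) V)" for p w
      unfolding std_function_def
    proof (rule exI[of _ p], rule exI[of _ w], intro conjI ballI)
      fix V assume "V \<in> ?G"
      then show "f V = sum (std_coeff n k p w) V"
        using that(2) sum_std_coeff[OF _ k, of V F n p w] that(1) unfolding admissible_def by simp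
    qed (rule that(1))
    assume ?R
    then consider "equal_on ?G f (\<lambda>V. 0)"
      | p where "p \<in> points F n" "equal_on ?G f (\<lambda>V. x_fun p V)"
      | r where "r \<in> points F n" "equal_on ?G f (\<lambda>V. 1 - y_fun r V)"
      | p r where "p \<in> points F n" "r \<in> points F n" "\<not> orthogonal_spaces p r"
        "equal_on ?G f (\<lambda>V. 1 - x_fun p V - y_fun r V)"
      unfolding Let_def by blast
    then show "std_function F n k f"
    proof cases
      case 1
      then show ?thesis
        by (intro intro[of ?z ?z]) (auto simp: admissible_def equal_on_def y0)
    next
      case (2 p)
      then obtain u where "u \<in> carrier_vec n" "u \<noteq> ?z" "p = line u"
        unfolding points_eq_lines by blast
      then show ?thesis using 2
        by (intro intro[of u ?z]) (auto simp: admissible_def equal_on_def y0)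
    next
      case (3 r)
      then obtain u where "u \<in> carrier_vec n" "u \<noteq> ?z" "r = line u"
        unfolding points_eq_lines by blast
      then show ?thesis using 3
        by (intro intro[of ?z u]) (auto simp: admissible_def equal_on_def)
    next
      case (4 p r)
      then obtain u w where uw: "u \<in> carrier_vec n" "u \<noteq> ?z" "p = line u"
        "w \<in> carrier_vec n" "w \<noteq> ?z" "r = line w"
        unfolding points_eq_lines by blast
      then have "admissible n u w"
        using 4(3) orthogonal_lines_iff[of u n w] unfolding admissible_def by simp
      then show ?thesis using 4(4) uw
        by (intro intro[of u w]) (auto simp: equal_on_def)
    qed
  qed
qed

lemma trivial_function_iff_std:
  fixes F :: "'q::{field,finite} itself"
  assumes "k \<ge> 2"
  shows "trivial_function F n k f \<longleftrightarrow> std_function F n k f \<or> std_function F n k (\<lambda>V. 1 - f V)"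
proof -
  let ?G = "grassmannian F n k"
  have eq: "equal_on ?G (\<lambda>V. 1 - f V) g \<longleftrightarrow> equal_on ?G f (\<lambda>V. 1 - g V)" for g
    unfolding equal_on_def by (auto simp: algebra_simps)
  have [simp]: "1 - (1 - a - b) = a + b" for a b :: real by simp
  show ?thesis
    unfolding std_function_iff[OF assms] trivial_function_def Let_def eq by auto
qed

text \<open>
  The same four cases in terms of coefficients.
\<close>

definition is_std_coeff :: "nat \<Rightarrow> nat \<Rightarrow> ('q::{field,finite} vec \<Rightarrow> real) \<Rightarrow> bool" where
  "is_std_coeff n k c \<longleftrightarrow>
    (\<exists>p w. admissible n p w \<and> (\<forall>v\<in>carrier_vec n. c v = std_coeff n k p w v))"

lemma sum_cong_grassmannian:
  assumes "V \<in> grassmannian F n k" "\<And>v. v \<in> carrier_vec n \<Longrightarrow> c v = d v"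
  shows "sum c V = sum d V"
  using assms vec_subspaceD(1) unfolding grassmannian_iff_card by (metis sum.cong)

lemma std_function_sum_iff:
  fixes F :: "'q::{field,finite} itself"
  assumes k: "2 \<le> k" "k < n" and c: "projective n c"
    and f: "\<And>V. V \<in> grassmannian F n k \<Longrightarrow> f V = sum c V"
  shows "std_function F n k f \<longleftrightarrow> is_std_coeff n k c"
proof
  assume "std_function F n k f"
  then obtain p w where adm: "admissible n p w"
    and eq: "\<And>V. V \<in> grassmannian F n k \<Longrightarrow> f V = sum (std_coeff n k p w) V"
    unfolding std_function_def by blast
  have proj: "projective n (\<lambda>v. c v - std_coeff n k p w v)"
    using adm unfolding admissible_def by (intro projective_diff c projective_std_coeff) auto
  have "c v - std_coeff n k p w v = 0" if "v \<in> carrier_vec n" for v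
    by (rule projective_zero_if_sums_zero[OF k proj _ that, where F = F])
      (simp add: sum_subtractf f[symmetric] eq)
  then show "is_std_coeff n k c" unfolding is_std_coeff_def using adm by auto
next
  assume "is_std_coeff n k c"
  then obtain p w where "admissible n p w" "\<And>v. v \<in> carrier_vec n \<Longrightarrow> c v = std_coeff n k p w v"
    unfolding is_std_coeff_def by blast
  then show "std_function F n k f"
    unfolding std_function_def using f sum_cong_grassmannian by metis
qed

lemma trivial_function_sum_iff:
  fixes F :: "'q::{field,finite} itself"
  assumes k: "2 \<le> k" "k < n" and c: "projective n c"
    and f: "\<And>V. V \<in> grassmannian F n k \<Longrightarrow> f V = sum c V"
  shows "trivial_function F n k f \<longleftrightarrow>
    is_std_coeff n k c \<or> is_std_coeff n k (\<lambda>v. one_coeff n k v - c v)"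
proof -
  have "1 - f V = sum (\<lambda>v. one_coeff n k v - c v) V" if "V \<in> grassmannian F n k" for V
    using sum_one_coeff[OF that k(1)] f[OF that] by (simp add: sum_subtractf)
  then show ?thesis
    unfolding trivial_function_iff_std[OF k(1)]
    using std_function_sum_iff[OF k c f]
      std_function_sum_iff[OF k projective_diff[OF projective_one_coeff c], of F "\<lambda>V. 1 - f V"]
    by simp
qed

text \<open>
  Being DOT as a property of coefficient functions. Uniqueness of coefficients enters here.
\<close>

lemma degree_one_trivial_iff:
  fixes F :: "'q::{field,finite} itself"
  assumes k: "2 \<le> k" "k < n"
  shows "degree_one_trivial F n k \<longleftrightarrow>
    (\<forall>c. projective n c \<and> (\<forall>V\<in>grassmannian F n k. sum c V \<in> {0, 1}) \<longrightarrow>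
      is_std_coeff n k c \<or> is_std_coeff n k (\<lambda>v. one_coeff n k v - c v))" (is "_ \<longleftrightarrow> ?R")
proof
  assume D: "degree_one_trivial F n k"
  show ?R
  proof (intro allI impI)
    fix c assume c: "projective n c \<and> (\<forall>V\<in>grassmannian F n k. sum c V \<in> {0, 1})"
    then have "degree_one F n k (sum c)" unfolding degree_one_iff_projective by blast
    then have "trivial_function F n k (sum c)"
      using D c unfolding degree_one_trivial_def boolean_on_def by blast
    then show "is_std_coeff n k c \<or> is_std_coeff n k (\<lambda>v. one_coeff n k v - c v)"
      using trivial_function_sum_iff[OF k, of c F "sum c"] c by simp
  qed
next
  assume R: ?R
  show "degree_one_trivial F n k"
    unfolding degree_one_trivial_def
  proof (intro allI impI)
    fix f assume f: "boolean_on (grassmannian F n k) f \<and> degree_one F n k f"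
    then obtain c where c: "projective n c" "\<And>V. V \<in> grassmannian F n k \<Longrightarrow> f V = sum c V"
      unfolding degree_one_iff_projective by blast
    have "\<forall>V\<in>grassmannian F n k. sum c V \<in> {0, 1}"
      using f c(2) unfolding boolean_on_def by metis
    then show "trivial_function F n k f"
      using R c trivial_function_sum_iff[OF k c] by simp
  qed
qed

section \<open>Subspaces of codimension at most one\<close>

lemma linear_functional_scalar_prod:
  fixes f :: "'q::field vec \<Rightarrow> 'q"
  assumes add: "\<And>u v. u \<in> carrier_vec n \<Longrightarrow> v \<in> carrier_vec n \<Longrightarrow> f (u + v) = f u + f v"
    and smult: "\<And>t v. v \<in> carrier_vec n \<Longrightarrow> f (t \<cdot>\<^sub>v v) = t * f v"
  obtains w where "w \<in> carrier_vec n" "\<And>v. v \<in> carrier_vec n \<Longrightarrow> f v = w \<bullet> v"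
proof -
  define w where "w = vec n (\<lambda>i. f (unit_vec n i))"
  have w: "w \<in> carrier_vec n" unfolding w_def by simp
  define g where "g v = f v - w \<bullet> v" for v
  have g0: "g (0\<^sub>v n) = 0"
  proof -
    have "0 \<cdot>\<^sub>v 0\<^sub>v n = (0\<^sub>v n :: 'q vec)" by (intro eq_vecI) auto
    then have "f (0\<^sub>v n) = 0" using smult[of "0\<^sub>v n" 0] by auto
    then show ?thesis using w unfolding g_def by simp
  qed
  have gadd: "g (u + v) = g u + g v" if "u \<in> carrier_vec n" "v \<in> carrier_vec n" for u v
    using add[OF that] scalar_prod_add_distrib[OF w that] unfolding g_def by simp
  have gunit: "g (t \<cdot>\<^sub>v unit_vec n i) = 0" if "i < n" for t i
    using smult[of "unit_vec n i" t] w that unfolding g_def by (simp add: w_def)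
  have "g v = 0" if v: "v \<in> carrier_vec n" for v
  proof -
    \<comment> \<open>truncations of \<open>v\<close> to its first \<open>j\<close> coordinates\<close>
    define tr where "tr j = vec n (\<lambda>i. if i < j then v $ i else 0)" for j
    have "g (tr j) = 0" if "j \<le> n" for j
      using that
    proof (induction j)
      case 0
      have "tr 0 = 0\<^sub>v n" unfolding tr_def by (intro eq_vecI) auto
      then show ?case using g0 by simp
    next
      case (Suc j)
      have "tr (Suc j) = tr j + v $ j \<cdot>\<^sub>v unit_vec n j"
        unfolding tr_def using Suc.prems by (intro eq_vecI) (auto simp: less_Suc_eq)
      then show ?case using Suc gadd[of "tr j" "v $ j \<cdot>\<^sub>v unit_vec n j"] gunit[of j]
        by (simp add: tr_def)
    qed
    moreover have "tr n = v" unfolding tr_def using v by (intro eq_vecI) auto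
    ultimately show ?thesis by auto
  qed
  then show thesis using that[OF w] unfolding g_def by simp
qed

lemma codim_le_1_perp:
  fixes Z :: "'q::{field,finite} vec set"
  assumes Z: "vec_subspace n Z"
    and codim: "\<And>u v. u \<in> carrier_vec n \<Longrightarrow> u \<notin> Z \<Longrightarrow> v \<in> carrier_vec n \<Longrightarrow> \<exists>t. v + t \<cdot>\<^sub>v u \<in> Z"
  obtains w where "w \<in> carrier_vec n" "Z = {v \<in> carrier_vec n. w \<bullet> v = 0}"
proof (cases "carrier_vec n \<subseteq> Z")
  case True
  then have "Z = {v \<in> carrier_vec n. 0\<^sub>v n \<bullet> v = 0}"
    using vec_subspaceD(1)[OF Z] by auto
  then show thesis using that[of "0\<^sub>v n"] by simp
next
  case False
  note ZD = vec_subspaceD[OF Z]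
  obtain u where u: "u \<in> carrier_vec n" "u \<notin> Z" using False by blast
  \<comment> \<open>the coordinate along \<open>u\<close> in the decomposition of the space into \<open>Z\<close> and \<open>line u\<close>\<close>
  define f where "f v = (SOME t. v + (- t) \<cdot>\<^sub>v u \<in> Z)" for v
  have f: "v + (- f v) \<cdot>\<^sub>v u \<in> Z" if v: "v \<in> carrier_vec n" for v
  proof -
    obtain t where "v + t \<cdot>\<^sub>v u \<in> Z" using codim[OF u v] by blast
    then have "v + (- (- t)) \<cdot>\<^sub>v u \<in> Z" by simp
    then show ?thesis unfolding f_def by (rule someI)
  qed
  have uniq: "f v = t" if v: "v \<in> carrier_vec n" and t: "v + (- t) \<cdot>\<^sub>v u \<in> Z" for v t
  proof (rule ccontr)
    assume ne: "f v \<noteq> t"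
    have "(v + (- t) \<cdot>\<^sub>v u) + (- 1) \<cdot>\<^sub>v (v + (- f v) \<cdot>\<^sub>v u) \<in> Z"
      using ZD t f[OF v] by blast
    then have "(1 / (f v - t)) \<cdot>\<^sub>v ((v + (- t) \<cdot>\<^sub>v u) + (- 1) \<cdot>\<^sub>v (v + (- f v) \<cdot>\<^sub>v u)) \<in> Z"
      using ZD by blast
    also have "(1 / (f v - t)) \<cdot>\<^sub>v ((v + (- t) \<cdot>\<^sub>v u) + (- 1) \<cdot>\<^sub>v (v + (- f v) \<cdot>\<^sub>v u)) = u"
    proof (rule eq_vecI)
      fix i assume i: "i < dim_vec u"
      have "(1 / (f v - t)) * ((v $ i - t * u $ i) - (v $ i - f v * u $ i)) = u $ i"
        using ne by (simp add: field_simps)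
      then show "((1 / (f v - t)) \<cdot>\<^sub>v ((v + (- t) \<cdot>\<^sub>v u) + (- 1) \<cdot>\<^sub>v (v + (- f v) \<cdot>\<^sub>v u))) $ i = u $ i"
        using i u v by simp
    qed (use u v in auto)
    finally show False using u by simp
  qed
  obtain w where w: "w \<in> carrier_vec n" "\<And>v. v \<in> carrier_vec n \<Longrightarrow> f v = w \<bullet> v"
  proof (rule linear_functional_scalar_prod[of n f])
    fix x y :: "'q vec" assume xy: "x \<in> carrier_vec n" "y \<in> carrier_vec n"
    have "(x + (- f x) \<cdot>\<^sub>v u) + (y + (- f y) \<cdot>\<^sub>v u) \<in> Z"
      using ZD f xy by blast
    also have "(x + (- f x) \<cdot>\<^sub>v u) + (y + (- f y) \<cdot>\<^sub>v u) = (x + y) + (- (f x + f y)) \<cdot>\<^sub>v u"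
      using u xy by (intro eq_vecI) (auto simp: algebra_simps)
    finally show "f (x + y) = f x + f y" using uniq xy by simp
  next
    fix t and x :: "'q vec" assume x: "x \<in> carrier_vec n"
    have "t \<cdot>\<^sub>v (x + (- f x) \<cdot>\<^sub>v u) \<in> Z" using ZD f x by blast
    also have "t \<cdot>\<^sub>v (x + (- f x) \<cdot>\<^sub>v u) = t \<cdot>\<^sub>v x + (- (t * f x)) \<cdot>\<^sub>v u"
      using u x by (intro eq_vecI) (auto simp: algebra_simps)
    finally show "f (t \<cdot>\<^sub>v x) = t * f x" using uniq x by simp
  qed (rule that)
  have f0: "v + (- 0) \<cdot>\<^sub>v u = v" if "v \<in> carrier_vec n" for v
    using that u by (intro eq_vecI) auto
  have "v \<in> Z \<longleftrightarrow> f v = 0" if v: "v \<in> carrier_vec n" for v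
    using uniq[OF v, of 0] f[OF v] f0[OF v] by auto
  then have "Z = {v \<in> carrier_vec n. w \<bullet> v = 0}"
    using ZD(1) w(2) by auto
  then show thesis using that w(1) by blast
qed

section \<open>Gluing along hyperplanes\<close>

text \<open>
  The possible values of \<open>std_coeff\<close>.
\<close>

definition std_values :: "real \<Rightarrow> nat \<Rightarrow> real set" where
  "std_values q k = {0, hyperplane_weight q k, point_weight q, hyperplane_weight q k - point_weight q}"

text \<open>
  The value at a vector determines whether the vector lies on the hyperplane and whether it
  belongs to the special point, because the four elements of \<open>std_values\<close> are distinct.
\<close>

lemma std_coeff_cases:
  fixes v :: "'q::{field,finite} vec" and k :: nat
  defines "\<beta> \<equiv> hyperplane_weight (real CARD('q)) k" and "\<delta> \<equiv> point_weight (real CARD('q))"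
  assumes k: "k \<ge> 2" and adm: "admissible n p w" and v: "v \<in> carrier_vec n"
  shows "std_coeff n k p w v \<in> std_values (real CARD('q)) k"
    and "std_coeff n k p w v \<in> {0, \<delta>} \<longleftrightarrow> w \<bullet> v = 0"
    and "std_coeff n k p w v \<in> {\<delta>, \<beta> - \<delta>} \<longleftrightarrow> v \<noteq> 0\<^sub>v n \<and> v \<in> line p"
proof -
  have q: "real CARD('q) \<ge> 2" using card_field_ge2[where 'q='q] by linarith
  have ineq: "0 < \<beta>" "2 * \<beta> \<le> \<delta>"
    using weights_ineq[OF q k] unfolding \<beta>_def \<delta>_def by linarith+
  have p: "p \<in> carrier_vec n" and w: "w \<in> carrier_vec n"
    using adm unfolding admissible_def by auto
  define A where "A \<longleftrightarrow> w \<bullet> v = 0"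
  define B where "B \<longleftrightarrow> v \<noteq> 0\<^sub>v n \<and> v \<in> line p"
  have w0: "A" if "w = 0\<^sub>v n" using that v unfolding A_def by simp
  \<comment> \<open>the special point does not lie on the hyperplane\<close>
  have nA: "\<not> A" if nz: "w \<noteq> 0\<^sub>v n" and B
  proof -
    obtain t where t: "v = t \<cdot>\<^sub>v p" using \<open>B\<close> unfolding B_def line_def by auto
    then have "t \<noteq> 0" "p \<noteq> 0\<^sub>v n" using \<open>B\<close> p unfolding B_def by auto
    then show ?thesis using adm nz t p w unfolding A_def admissible_def by auto
  qed
  have val: "std_coeff n k p w v = (if A then 0 else \<beta>) + (if B then (if w = 0\<^sub>v n then 1 else - 1) * \<delta> else 0)"
    unfolding std_coeff_def A_def B_def \<beta>_def \<delta>_def by simp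
  have "std_coeff n k p w v = (if B then (if A then \<delta> else \<beta> - \<delta>) else if A then 0 else \<beta>)"
    unfolding val using w0 nA by auto
  then show "std_coeff n k p w v \<in> std_values (real CARD('q)) k"
    and "std_coeff n k p w v \<in> {0, \<delta>} \<longleftrightarrow> w \<bullet> v = 0"
    and "std_coeff n k p w v \<in> {\<delta>, \<beta> - \<delta>} \<longleftrightarrow> v \<noteq> 0\<^sub>v n \<and> v \<in> line p"
    unfolding std_values_def \<beta>_def[symmetric] \<delta>_def[symmetric] A_def[symmetric] B_def[symmetric]
    using ineq by (auto split: if_splits)
qed

text \<open>
  The values alone tell the coefficients of the four functions from those of their complements.
\<close>

lemma std_values_disjoint:
  assumes "q \<ge> 2" "k \<ge> 2" "x \<in> std_values q k"
  shows "one_weight q k - x \<notin> std_values q k"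
  using weights_ineq[OF assms(1,2)] assms(3) unfolding std_values_def by auto

text \<open>
  Membership of a vector in \<open>Z\<close> (the hyperplane, or the whole space if there is none) and in \<open>D\<close>
  (the nonzero vectors of the special point) is read off from its value, so it does not depend
  on the embedding used. Statements about two vectors can be verified on an embedded copy of
  \<open>\<F>\<^sub>q\<^sup>n\<close> that contains both. In this way \<open>Z\<close> is a subspace that meets nontrivially
  every two-dimensional space, hence of codimension at most one; \<open>D\<close> lies on one line; and \<open>D\<close> is
  disjoint from \<open>Z\<close> unless \<open>Z\<close> is everything.
\<close>

lemma is_std_coeff_glue:
  fixes c :: "'q::{field,finite} vec \<Rightarrow> real"
  assumes k: "k \<ge> 2" and c: "projective N c"
    and cover: "\<And>u v. u \<in> carrier_vec N \<Longrightarrow> v \<in> carrier_vec N \<Longrightarrow>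
      \<exists>M. linear_embedding n N M \<and> {u, v} \<subseteq> M ` carrier_vec n \<and> is_std_coeff n k (\<lambda>x. c (M x))"
  shows "is_std_coeff N k c"
proof -
  define \<beta> where "\<beta> = hyperplane_weight (real CARD('q)) k"
  define \<delta> where "\<delta> = point_weight (real CARD('q))"
  have q: "real CARD('q) \<ge> 2" using card_field_ge2[where 'q='q] by linarith
  have ineq: "0 < \<beta>" "2 * \<beta> \<le> \<delta>"
    using weights_ineq[OF q k] unfolding \<beta>_def \<delta>_def by linarith+
  note cases = std_coeff_cases[where 'q='q, OF k, folded \<beta>_def \<delta>_def]
  define Z where "Z = {v \<in> carrier_vec N. c v \<in> {0, \<delta>}}"
  define D where "D = {v \<in> carrier_vec N. c v \<in> {\<delta>, \<beta> - \<delta>}}"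
  have local: "\<exists>M p w x y. linear_embedding n N M \<and> admissible n p w \<and>
      x \<in> carrier_vec n \<and> y \<in> carrier_vec n \<and> u = M x \<and> v = M y \<and>
      (\<forall>z\<in>carrier_vec n. c (M z) \<in> std_values (real CARD('q)) k \<and>
        (M z \<in> Z \<longleftrightarrow> w \<bullet> z = 0) \<and> (M z \<in> D \<longleftrightarrow> z \<noteq> 0\<^sub>v n \<and> z \<in> line p))"
    if uv: "u \<in> carrier_vec N" "v \<in> carrier_vec N" for u v
  proof -
    obtain M where M: "linear_embedding n N M" "{u, v} \<subseteq> M ` carrier_vec n"
      "is_std_coeff n k (\<lambda>x. c (M x))"
      using cover[OF uv] by blast
    obtain p w where pw: "admissible n p w" "\<And>z. z \<in> carrier_vec n \<Longrightarrow> c (M z) = std_coeff n k p w z"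
      using M(3) unfolding is_std_coeff_def by blast
    obtain x y where "x \<in> carrier_vec n" "y \<in> carrier_vec n" "u = M x" "v = M y"
      using M(2) by blast
    moreover have "c (M z) \<in> std_values (real CARD('q)) k \<and>
        (M z \<in> Z \<longleftrightarrow> w \<bullet> z = 0) \<and> (M z \<in> D \<longleftrightarrow> z \<noteq> 0\<^sub>v n \<and> z \<in> line p)"
      if z: "z \<in> carrier_vec n" for z
      unfolding Z_def D_def
      using cases[OF pw(1) z] linear_embeddingD(1)[OF M(1) z] pw(2)[OF z] by simp
    ultimately show ?thesis using M(1) pw(1) by blast
  qed
  have std_val: "c v \<in> std_values (real CARD('q)) k" if "v \<in> carrier_vec N" for v
    using local[OF that that] by blast
  have Zsub: "vec_subspace N Z"
    unfolding vec_subspace_def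
  proof (intro conjI ballI allI)
    show "Z \<subseteq> carrier_vec N" unfolding Z_def by blast
    show "0\<^sub>v N \<in> Z" unfolding Z_def using projectiveD(1)[OF c] by simp
    fix u v assume uv: "u \<in> Z" "v \<in> Z"
    then have "u \<in> carrier_vec N" "v \<in> carrier_vec N" unfolding Z_def by auto
    from local[OF this] obtain M p w x y where M: "linear_embedding n N M" "admissible n p w"
      and xy: "x \<in> carrier_vec n" "y \<in> carrier_vec n" "u = M x" "v = M y"
      and Z: "\<And>z. z \<in> carrier_vec n \<Longrightarrow> M z \<in> Z \<longleftrightarrow> w \<bullet> z = 0"
      by blast
    have "w \<bullet> (x + y) = 0"
      using Z[OF xy(1)] Z[OF xy(2)] xy uv M(2) scalar_prod_add_distrib[of w n x y]
      unfolding admissible_def by simp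
    then show "u + v \<in> Z"
      using Z[of "x + y"] xy linear_embeddingD(3)[OF M(1) xy(1,2)] by simp
  next
    fix t v assume v: "v \<in> Z"
    then have vc: "v \<in> carrier_vec N" unfolding Z_def by simp
    show "t \<cdot>\<^sub>v v \<in> Z"
    proof (cases "t = 0")
      case True
      then have "t \<cdot>\<^sub>v v = 0\<^sub>v N" using vc by auto
      then show ?thesis unfolding Z_def using projectiveD(1)[OF c] by simp
    next
      case False
      then show ?thesis using projectiveD(2)[OF c vc False] v vc unfolding Z_def by simp
    qed
  qed
  have "\<exists>t. v + t \<cdot>\<^sub>v u \<in> Z" if u: "u \<in> carrier_vec N" "u \<notin> Z" and v: "v \<in> carrier_vec N" for u v
  proof -
    from local[OF u(1) v] obtain M p w x y where M: "linear_embedding n N M" "admissible n p w"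
      and xy: "x \<in> carrier_vec n" "y \<in> carrier_vec n" "u = M x" "v = M y"
      and Z: "\<And>z. z \<in> carrier_vec n \<Longrightarrow> M z \<in> Z \<longleftrightarrow> w \<bullet> z = 0"
      by blast
    have wx: "w \<bullet> x \<noteq> 0" using Z[OF xy(1)] u(2) xy by simp
    let ?t = "- (w \<bullet> y) / (w \<bullet> x)"
    have "w \<bullet> (y + ?t \<cdot>\<^sub>v x) = 0"
      using M(2) xy wx scalar_prod_add_distrib[of w n y "?t \<cdot>\<^sub>v x"]
      unfolding admissible_def by simp
    moreover have "v + ?t \<cdot>\<^sub>v u = M (y + ?t \<cdot>\<^sub>v x)"
      using linear_embeddingD(3,4)[OF M(1)] xy by simp
    ultimately have "v + ?t \<cdot>\<^sub>v u \<in> Z" using Z[of "y + ?t \<cdot>\<^sub>v x"] xy by simp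
    then show ?thesis by blast
  qed
  then obtain W where W: "W \<in> carrier_vec N" "Z = {v \<in> carrier_vec N. W \<bullet> v = 0}"
    using codim_le_1_perp[OF Zsub] by metis
  have D_line: "v \<in> line u" if D: "u \<in> D" "v \<in> D" for u v
  proof -
    have "u \<in> carrier_vec N" "v \<in> carrier_vec N" using D unfolding D_def by auto
    from local[OF this] obtain M p w x y where M: "linear_embedding n N M" "admissible n p w"
      and xy: "x \<in> carrier_vec n" "y \<in> carrier_vec n" "u = M x" "v = M y"
      and DM: "\<And>z. z \<in> carrier_vec n \<Longrightarrow> M z \<in> D \<longleftrightarrow> z \<noteq> 0\<^sub>v n \<and> z \<in> line p"
      by blast
    have "p \<in> carrier_vec n" using M(2) unfolding admissible_def by simp
    then have "line x = line p"
      using line_eq_if_mem[of p n x] DM[OF xy(1)] D xy by simp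
    then have "y \<in> line x" using DM[OF xy(2)] D xy by simp
    then obtain t where "y = t \<cdot>\<^sub>v x" unfolding line_def by auto
    then have "v = t \<cdot>\<^sub>v u" using linear_embeddingD(4)[OF M(1)] xy by simp
    then show ?thesis using mem_line(1) by simp
  qed
  have D_Z: "u \<notin> Z" if D: "u \<in> D" and v: "v \<in> carrier_vec N" "v \<notin> Z" for u v
  proof -
    have "u \<in> carrier_vec N" using D unfolding D_def by auto
    from local[OF this v(1)] obtain M p w x y where M: "linear_embedding n N M" "admissible n p w"
      and xy: "x \<in> carrier_vec n" "y \<in> carrier_vec n" "u = M x" "v = M y"
      and Z: "\<And>z. z \<in> carrier_vec n \<Longrightarrow> M z \<in> Z \<longleftrightarrow> w \<bullet> z = 0"
      and DM: "\<And>z. z \<in> carrier_vec n \<Longrightarrow> M z \<in> D \<longleftrightarrow> z \<noteq> 0\<^sub>v n \<and> z \<in> line p"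
      by blast
    have pc: "p \<in> carrier_vec n" "w \<in> carrier_vec n" using M(2) unfolding admissible_def by auto
    have x: "x \<noteq> 0\<^sub>v n" "x \<in> line p" using DM[OF xy(1)] D xy by auto
    obtain t where t: "x = t \<cdot>\<^sub>v p" using x(2) unfolding line_def by auto
    have "w \<noteq> 0\<^sub>v n" using Z[OF xy(2)] v(2) xy by auto
    moreover have "t \<noteq> 0" "p \<noteq> 0\<^sub>v n" using x t pc by auto
    ultimately have "w \<bullet> x \<noteq> 0" using t M(2) pc unfolding admissible_def by auto
    then show ?thesis using Z[OF xy(1)] xy by simp
  qed
  have c_val: "c v = (if v \<in> D then (if v \<in> Z then \<delta> else \<beta> - \<delta>) else if v \<in> Z then 0 else \<beta>)"
    if v: "v \<in> carrier_vec N" for v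
    using std_val[OF v] v ineq unfolding std_values_def Z_def D_def \<beta>_def[symmetric] \<delta>_def[symmetric]
    by auto
  have DZ_W: "v \<in> Z \<longleftrightarrow> W = 0\<^sub>v N" if v: "v \<in> D" for v
  proof (cases "W = 0\<^sub>v N")
    case True
    then show ?thesis using v W(2) unfolding D_def by auto
  next
    case False
    then obtain i where "i < N" "W $ i \<noteq> 0" using nonzero_vec_coordinate[OF W(1)] by metis
    then have "unit_vec N i \<notin> Z" using W by simp
    then show ?thesis using D_Z[OF v, of "unit_vec N i"] False by simp
  qed
  define p where "p = (if D = {} then 0\<^sub>v N else SOME p. p \<in> D)"
  have pD: "p \<in> D" if "D \<noteq> {}"
    unfolding p_def using that by (simp add: some_in_eq)
  have D0: "0\<^sub>v N \<notin> D" unfolding D_def using projectiveD(1)[OF c] ineq by simp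
  have pc: "p \<in> carrier_vec N"
    using pD unfolding p_def D_def by (cases "D = {}") (auto simp: p_def D_def)
  have D_iff: "v \<in> D \<longleftrightarrow> v \<noteq> 0\<^sub>v N \<and> v \<in> line p" if v: "v \<in> carrier_vec N" for v
  proof
    assume "v \<in> D"
    then show "v \<noteq> 0\<^sub>v N \<and> v \<in> line p" using D0 pD D_line by blast
  next
    assume R: "v \<noteq> 0\<^sub>v N \<and> v \<in> line p"
    then obtain t where t: "v = t \<cdot>\<^sub>v p" unfolding line_def by auto
    have tp: "t \<noteq> 0" "p \<noteq> 0\<^sub>v N" using R t pc by auto
    then have "p \<in> D" using pD unfolding p_def by auto
    then show "v \<in> D" using projectiveD(2)[OF c pc tp(1)] t v unfolding D_def by simp
  qed
  have "admissible N p W"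
    unfolding admissible_def using pc W DZ_W[of p] D_iff[OF pc] mem_line(2)[of p] by auto
  moreover have "c v = std_coeff N k p W v" if v: "v \<in> carrier_vec N" for v
    unfolding c_val[OF v] std_coeff_def \<beta>_def[symmetric] \<delta>_def[symmetric] D_iff[OF v, symmetric]
    using DZ_W[of v] W v by auto
  ultimately show ?thesis unfolding is_std_coeff_def by blast
qed

lemma is_std_coeff_cong:
  "is_std_coeff n k c \<Longrightarrow> (\<And>v. v \<in> carrier_vec n \<Longrightarrow> c v = d v) \<Longrightarrow> is_std_coeff n k d"
  unfolding is_std_coeff_def by metis

lemma one_coeff_linear_embedding:
  assumes "linear_embedding n N M" "x \<in> carrier_vec n"
  shows "one_coeff N k (M x) = one_coeff n k x"
proof -
  have "M x = 0\<^sub>v N \<longleftrightarrow> x = 0\<^sub>v n"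
    using linear_embedding_zero[OF assms(1)] inj_onD[OF linear_embeddingD(2)[OF assms(1)] _ assms(2)]
    by auto
  then show ?thesis unfolding one_coeff_def by simp
qed

text \<open>
  The value at one fixed nonzero vector decides, for all hyperplanes through it at once, whether
  \<open>c\<close> or its complement \<open>d\<close> restricts to standard coefficients.
\<close>

lemma degree_one_trivial_Suc:
  fixes F :: "'q::{field,finite} itself"
  assumes k: "2 \<le> k" "k < n" and dot: "degree_one_trivial F n k"
  shows "degree_one_trivial F (Suc n) k"
proof -
  have k': "k < Suc n" using k by simp
  have q: "real CARD('q) \<ge> 2" using card_field_ge2[where 'q='q] by linarith
  show ?thesis
    unfolding degree_one_trivial_iff[OF k(1) k']
  proof (intro allI impI)
    fix c :: "'q vec \<Rightarrow> real"
    assume c: "projective (Suc n) c \<and> (\<forall>V\<in>grassmannian F (Suc n) k. sum c V \<in> {0, 1})"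
    define d where "d v = one_coeff (Suc n) k v - c v" for v
    have d: "projective (Suc n) d"
      unfolding d_def using c by (intro projective_diff projective_one_coeff) simp
    have restrict: "is_std_coeff n k (\<lambda>x. c (M x)) \<or> is_std_coeff n k (\<lambda>x. d (M x))"
      if M: "linear_embedding n (Suc n) M" for M
    proof -
      have "sum (\<lambda>x. c (M x)) V \<in> {0, 1}" if V: "V \<in> grassmannian F n k" for V
      proof -
        have "sum c (M ` V) \<in> {0, 1}" using c grassmannian_image[OF M V] by blast
        then show ?thesis
          using sum_image_linear_embedding[OF M, of V c] V by (simp add: grassmannian_iff_card)
      qed
      then have "is_std_coeff n k (\<lambda>x. c (M x)) \<or> is_std_coeff n k (\<lambda>x. one_coeff n k x - c (M x))"
        using dot projective_comp[OF M] c unfolding degree_one_trivial_iff[OF k] by blast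
      then show ?thesis
        using one_coeff_linear_embedding[OF M] is_std_coeff_cong unfolding d_def by fastforce
    qed
    let ?e = "unit_vec (Suc n) 0 :: 'q vec"
    have std_val: "f ?e \<in> std_values (real CARD('q)) k"
      if e: "?e \<in> M ` carrier_vec n" and tr: "is_std_coeff n k (\<lambda>x. f (M x))" for f and M :: "'q vec \<Rightarrow> 'q vec"
    proof -
      obtain x where x: "x \<in> carrier_vec n" "?e = M x" using e by blast
      obtain p w where "admissible n p w" "f (M x) = std_coeff n k p w x"
        using tr x(1) unfolding is_std_coeff_def by blast
      then show ?thesis using std_coeff_cases(1)[OF k(1) _ x(1)] x(2) by simp
    qed
    have "?e \<noteq> 0\<^sub>v (Suc n)" by (rule unit_vec_nonzero) simp
    then have de: "d ?e = one_weight (real CARD('q)) k - c ?e"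
      unfolding d_def one_coeff_def by simp
    have cover: "\<exists>M. linear_embedding n (Suc n) M \<and> {u, v, ?e} \<subseteq> M ` carrier_vec n"
      if uv: "u \<in> carrier_vec (Suc n)" "v \<in> carrier_vec (Suc n)" for u v
    proof -
      have "n \<ge> 3" using k by simp
      then obtain M where "linear_embedding n (Suc n) M" "{u, v, ?e} \<subseteq> M ` carrier_vec n"
        using hyperplane_through_three[of n u v ?e] uv by auto
      then show ?thesis by blast
    qed
    show "is_std_coeff (Suc n) k c \<or> is_std_coeff (Suc n) k (\<lambda>v. one_coeff (Suc n) k v - c v)"
    proof (cases "c ?e \<in> std_values (real CARD('q)) k")
      case True
      then have "d ?e \<notin> std_values (real CARD('q)) k"
        unfolding de by (rule std_values_disjoint[OF q k(1)])
      then have "\<exists>M. linear_embedding n (Suc n) M \<and> {u, v} \<subseteq> M ` carrier_vec n \<and>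
          is_std_coeff n k (\<lambda>x. c (M x))"
        if "u \<in> carrier_vec (Suc n)" "v \<in> carrier_vec (Suc n)" for u v
        using cover[OF that] restrict std_val[of _ d] by (metis insert_subset)
      then show ?thesis using is_std_coeff_glue[OF k(1)] c by blast
    next
      case False
      then have "\<exists>M. linear_embedding n (Suc n) M \<and> {u, v} \<subseteq> M ` carrier_vec n \<and>
          is_std_coeff n k (\<lambda>x. d (M x))"
        if "u \<in> carrier_vec (Suc n)" "v \<in> carrier_vec (Suc n)" for u v
        using cover[OF that] restrict std_val[of _ c] by (metis insert_subset)
      then show ?thesis using is_std_coeff_glue[OF k(1) d] unfolding d_def by blast
    qed
  qed
qed

theorem proposition4p1:
  fixes F :: "'q::{field,finite} itself" and a b :: nat
  assumes "a \<ge> 2" and "b \<ge> 2"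
    and "DOT F a b"
  shows "\<forall>a'\<ge>a. DOT F a' b"
proof (intro allI impI)
  fix a' assume "a \<le> a'"
  then show "DOT F a' b"
  proof (induction a' rule: dec_induct)
    case (step m)
    then show ?case
      using degree_one_trivial_Suc[of b "m + b" F] assms(1,2) by simp
  qed (rule assms(3))
qed

end
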